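(* Let $n\ge3$ and let $w=(w_1,\dots,w_n)$ be distributed according to the stationary distribution of the multispecies TASEP on a ring with $n$ sites of type $(1,1,\dots,1)$. For $1\le i<j<k\le n$, $$\mathbb P(w_1=j,\ w_2=i,\ w_3=k)=\begin{cases}\dfrac{2(j-i)}{n^3(n-1)}, & k>j+1,\\[3mm] \dfrac{2(j-i)}{n(n-1)}\left(\dfrac1{n^2}+\dfrac{j(n-j)}{n^2(n-1)}\right)+\dfrac{2j(j-1)(n-j)}{n^3(n-1)^2(n-2)}, & k=j+1.\end{cases}$$
   Context: Multispecies TASEP on a ring with $n$ sites of type $(1,\dots,1)$: the states are the permutations $w=(w_1,\dots,w_n)$ of $\{1,\dots,n\}$, with positions taken cyclically modulo $n$ ($w_i$ is the species of the particle at site $i$). It is the continuous-time Markov chain in which every particle carries an independent rate-$1$ exponential clock; when the clock of the particle of species $j$ rings, it exchanges positions with the particle of species $k$ immediately to its left if $k>j$, and nothing happens otherwise. It has a unique stationary distribution. *)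

theory Defs
  imports "HOL-Probability.Probability_Mass_Function" "HOL-Combinatorics.Permutations"
begin

text \<open>
  A continuous-time Markov chain on a finite state space \<open>S\<close> is given by its generator
  \<open>Q\<close> (\<open>Q u v\<close> is the jump rate from \<open>u\<close> to \<open>v\<close> for \<open>u \<noteq> v\<close>, and the rows of \<open>Q\<close> sum to 0);
  its transition probabilities at time \<open>t\<close> are the entries of the matrix exponential of \<open>t Q\<close>.
\<close>

primrec gen_power :: "'a set \<Rightarrow> ('a \<Rightarrow> 'a \<Rightarrow> real) \<Rightarrow> nat \<Rightarrow> 'a \<Rightarrow> 'a \<Rightarrow> real" where
  "gen_power S Q 0 u v = of_bool (u = v)"
| "gen_power S Q (Suc m) u v = (\<Sum>x\<in>S. gen_power S Q m u x * Q x v)"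

definition transition_prob :: "'a set \<Rightarrow> ('a \<Rightarrow> 'a \<Rightarrow> real) \<Rightarrow> real \<Rightarrow> 'a \<Rightarrow> 'a \<Rightarrow> real" where
  "transition_prob S Q t u v = (\<Sum>m. t ^ m / fact m * gen_power S Q m u v)"

definition stationary :: "'a set \<Rightarrow> ('a \<Rightarrow> 'a \<Rightarrow> real) \<Rightarrow> 'a pmf \<Rightarrow> bool" where
  "stationary S Q p \<longleftrightarrow>
     set_pmf p \<subseteq> S \<and>
     (\<forall>t\<ge>0. \<forall>v\<in>S. (\<Sum>u\<in>S. pmf p u * transition_prob S Q t u v) = pmf p v)"

text \<open>
  States are permutations \<open>w\<close> of \<open>{1..n}\<close>, where \<open>w s\<close> is the species of the particle at site \<open>s\<close>.
\<close>

definition tasep_states :: "nat \<Rightarrow> (nat \<Rightarrow> nat) set" where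
  "tasep_states n = {w. w permutes {1..n}}"

definition left_site :: "nat \<Rightarrow> nat \<Rightarrow> nat" where
  "left_site n s = (if s = 1 then n else s - 1)"

text \<open>The state after the clock of the particle at site \<open>s\<close> has rung.\<close>

definition tasep_ring :: "nat \<Rightarrow> (nat \<Rightarrow> nat) \<Rightarrow> nat \<Rightarrow> (nat \<Rightarrow> nat)" where
  "tasep_ring n w s =
     (let l = left_site n s in if w l > w s then w(l := w s, s := w l) else w)"

text \<open>
  Each clock rings at rate 1, so the generator acts on functions by
  \<open>f \<mapsto> (\<lambda>w. \<Sum>s=1..n. f (tasep_ring n w s) - f w)\<close>; rings that change nothing contribute 0.
\<close>

definition tasep_generator :: "nat \<Rightarrow> (nat \<Rightarrow> nat) \<Rightarrow> (nat \<Rightarrow> nat) \<Rightarrow> real" where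
  "tasep_generator n w w' = (\<Sum>s=1..n. of_bool (tasep_ring n w s = w') - of_bool (w = w'))"

definition tasep_stationary :: "nat \<Rightarrow> (nat \<Rightarrow> nat) pmf \<Rightarrow> bool" where
  "tasep_stationary n p \<longleftrightarrow> stationary (tasep_states n) (tasep_generator n) p"

end

theory Submission imports Defs begin

text \<open>
  For every threshold \<open>a\<close> the set \<open>{s. w s \<le> a}\<close> performs a one-species TASEP driven by the same clocks,
  and \<open>P(w 1 = j, w 2 = i, w 3 = k)\<close> is a mixed difference, in the three thresholds, of
  \<open>P(b < w 1 \<le> c, w 2 \<le> a, c < w 3)\<close> with \<open>a \<le> b < c\<close>.  The law of the three nested sets is that of the
  Ferrari-Martin multiline queue with three independent uniform lines of \<open>a\<close>, \<open>b\<close> and \<open>c\<close> particles: bells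
  can be passed up through the lines so that the uniform law is preserved and the departure
  processes follow the TASEP, whose stationary law is unique because every configuration can be
  sorted.  In the multiline queue the event factorises, up to a three-candidate ballot event that
  is counted by a \<open>3 \<times> 3\<close> determinant of binomial coefficients.
\<close>

subsection \<open>Invariant weights of finite random maps\<close>

text \<open>The event involves three species only, so three thresholds suffice and no queue with a
  line for every species is needed. The three levels react to one clock, hence the queues have to be
  compatible with every single ring. The obstacle is a ring at a site without a service whose left
  neighbour has one: handed on unchanged it could alter the departures. Such rings are sent to sites
  where a service follows a gap; the two kinds of sites are equally many, and any bijection between
  them will do.

  For \<open>a = 0\<close> these are all of them, so one determinant gives both the product term and
  the correction.

  The two cases of the formula come from the mixed difference: \<open>corr\<close> is one rational
  function for all \<open>a \<le> b < c\<close>, but for \<open>k = j + 1\<close> two of the eight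
  terms have \<open>b = c\<close>, where the event is empty although \<open>corr\<close> need not
  vanish.\<close>

definition invariant_weight :: "'i set \<Rightarrow> ('i \<Rightarrow> 'x \<Rightarrow> 'x) \<Rightarrow> 'x set \<Rightarrow> ('x \<Rightarrow> real) \<Rightarrow> bool" where
  "invariant_weight I T X \<mu> \<longleftrightarrow>
     (\<forall>y\<in>X. (\<Sum>s\<in>I. \<Sum>x | x \<in> X \<and> T s x = y. \<mu> x) = real (card I) * \<mu> y)"

lemma invariant_weight_linear:
  assumes "invariant_weight I T X \<mu>" "invariant_weight I T X \<nu>"
  shows "invariant_weight I T X (\<lambda>x. r * \<mu> x + t * \<nu> x)"
  unfolding invariant_weight_def
proof
  fix y assume "y \<in> X"
  have "(\<Sum>s\<in>I. \<Sum>x | x \<in> X \<and> T s x = y. r * \<mu> x + t * \<nu> x)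
      = r * (\<Sum>s\<in>I. \<Sum>x | x \<in> X \<and> T s x = y. \<mu> x) + t * (\<Sum>s\<in>I. \<Sum>x | x \<in> X \<and> T s x = y. \<nu> x)"
    by (simp add: sum.distrib sum_distrib_left)
  also have "\<dots> = real (card I) * (r * \<mu> y + t * \<nu> y)"
    using assms \<open>y \<in> X\<close> unfolding invariant_weight_def by (simp add: algebra_simps)
  finally show "(\<Sum>s\<in>I. \<Sum>x | x \<in> X \<and> T s x = y. r * \<mu> x + t * \<nu> x)
      = real (card I) * (r * \<mu> y + t * \<nu> y)" .
qed

lemma sum_fibres:
  fixes g :: "'x \<Rightarrow> real"
  assumes "finite X" "finite Y" "f ` X \<subseteq> Y"
  shows "(\<Sum>y\<in>Y. \<Sum>x | x \<in> X \<and> f x = y. g x) = (\<Sum>x\<in>X. g x)"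
  using sum.group[OF assms] by simp

text \<open>The triangle inequality gives one direction at each point. Every \<open>T s\<close>
  preserves total mass, so both sides have the same sum over \<open>X\<close>, and the inequality is
  an equality everywhere.\<close>

lemma invariant_weight_abs:
  assumes fin: "finite X" "finite I" and T: "\<And>s. s \<in> I \<Longrightarrow> T s ` X \<subseteq> X"
    and inv: "invariant_weight I T X d"
  shows "invariant_weight I T X (\<lambda>x. \<bar>d x\<bar>)"
proof -
  let ?F = "\<lambda>y. \<Sum>s\<in>I. \<Sum>x | x \<in> X \<and> T s x = y. \<bar>d x\<bar>"
  have le: "real (card I) * \<bar>d y\<bar> \<le> ?F y" if "y \<in> X" for y
  proof -
    have "real (card I) * \<bar>d y\<bar> = \<bar>\<Sum>s\<in>I. \<Sum>x | x \<in> X \<and> T s x = y. d x\<bar>"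
      using inv that by (simp add: invariant_weight_def abs_mult)
    also have "\<dots> \<le> (\<Sum>s\<in>I. \<bar>\<Sum>x | x \<in> X \<and> T s x = y. d x\<bar>)"
      by (rule sum_abs)
    also have "\<dots> \<le> ?F y"
      by (intro sum_mono sum_abs)
    finally show ?thesis .
  qed
  have "(\<Sum>y\<in>X. ?F y) = (\<Sum>s\<in>I. \<Sum>y\<in>X. \<Sum>x | x \<in> X \<and> T s x = y. \<bar>d x\<bar>)"
    by (rule sum.swap)
  also have "\<dots> = (\<Sum>s\<in>I. \<Sum>x\<in>X. \<bar>d x\<bar>)"
    using fin T by (intro sum.cong refl sum_fibres) auto
  finally have "(\<Sum>y\<in>X. ?F y - real (card I) * \<bar>d y\<bar>) = 0"
    by (simp add: sum_subtractf sum_distrib_left)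
  then have "\<forall>y\<in>X. ?F y - real (card I) * \<bar>d y\<bar> = 0"
    using le fin by (subst (asm) sum_nonneg_eq_0_iff) auto
  then show ?thesis
    unfolding invariant_weight_def by simp
qed

text \<open>Invariance passes at least the fraction \<open>1 / card I\<close> of the mass at
  \<open>x\<close> on to each \<open>T s x\<close>, so positivity follows any path of maps; descent
  of \<open>\<Phi>\<close> makes some path end in \<open>z\<close>.\<close>

lemma invariant_weight_pos_at_sink:
  assumes fin: "finite X" "finite I" and T: "\<And>s. s \<in> I \<Longrightarrow> T s ` X \<subseteq> X"
    and inv: "invariant_weight I T X f" and nonneg: "\<And>x. x \<in> X \<Longrightarrow> f x \<ge> 0"
    and desc: "\<And>x. x \<in> X \<Longrightarrow> x \<noteq> z \<Longrightarrow> \<exists>s\<in>I. \<Phi> (T s x) < (\<Phi> x :: nat)"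
    and "x \<in> X" "f x > 0"
  shows "f z > 0"
  using assms(7,8)
proof (induction "\<Phi> x" arbitrary: x rule: less_induct)
  case less
  show ?case
  proof (cases "x = z")
    case False
    then obtain s where s: "s \<in> I" "\<Phi> (T s x) < \<Phi> x"
      using desc less by blast
    have TX: "T s x \<in> X" using T s less by blast
    have "f x \<le> (\<Sum>u | u \<in> X \<and> T s u = T s x. f u)"
      using fin nonneg less by (intro member_le_sum) auto
    also have "\<dots> \<le> (\<Sum>r\<in>I. \<Sum>u | u \<in> X \<and> T r u = T s x. f u)"
      using fin nonneg s
      by (intro member_le_sum[where f="\<lambda>r. \<Sum>u | u \<in> X \<and> T r u = T s x. f u"] sum_nonneg) auto
    also have "\<dots> = real (card I) * f (T s x)"
      using inv TX by (simp add: invariant_weight_def)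
    finally have "f (T s x) > 0"
      using less by (smt (verit) mult_nonneg_nonpos of_nat_0_le_iff)
    then show ?thesis using less s TX by blast
  qed (use less in simp)
qed

text \<open>For the difference \<open>d\<close>, both \<open>\<bar>d\<bar> + d\<close> and
  \<open>\<bar>d\<bar> - d\<close> are nonnegative invariant weights, so a positive or negative
  value anywhere forces the same sign at \<open>z\<close>. Hence \<open>d\<close> has one sign, and
  its sum is 0.\<close>

lemma invariant_weight_unique:
  assumes fin: "finite X" "finite I" and T: "\<And>s. s \<in> I \<Longrightarrow> T s ` X \<subseteq> X"
    and inv: "invariant_weight I T X \<mu>" "invariant_weight I T X \<nu>"
    and total: "sum \<mu> X = sum \<nu> X"
    and desc: "\<And>x. x \<in> X \<Longrightarrow> x \<noteq> z \<Longrightarrow> \<exists>s\<in>I. \<Phi> (T s x) < (\<Phi> x :: nat)"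
    and "x \<in> X"
  shows "\<mu> x = \<nu> x"
proof -
  define d where "d x = \<mu> x - \<nu> x" for x
  have d: "invariant_weight I T X d"
    using invariant_weight_linear[OF inv, of 1 "-1"] by (simp add: d_def[abs_def])
  have d0: "sum d X = 0" using total by (simp add: d_def sum_subtractf)
  note ab = invariant_weight_abs[OF fin T d]
  have pos: "d y \<le> 0" if "y \<in> X" "d z \<le> 0" for y
  proof (rule ccontr)
    assume neg: "\<not> ?thesis"
    have "1 * \<bar>d z\<bar> + 1 * d z > 0"
      by (rule invariant_weight_pos_at_sink[OF fin T invariant_weight_linear[OF ab d], where \<Phi>=\<Phi> and x=y])
         (use desc that neg in auto)
    then show False using that by simp
  qed
  have neg: "d y \<ge> 0" if "y \<in> X" "d z \<ge> 0" for y
  proof (rule ccontr)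
    assume neg: "\<not> ?thesis"
    have "1 * \<bar>d z\<bar> + (-1) * d z > 0"
      by (rule invariant_weight_pos_at_sink[OF fin T invariant_weight_linear[OF ab d], where \<Phi>=\<Phi> and x=y])
         (use desc that neg in auto)
    then show False using that by simp
  qed
  have "d x = 0"
  proof (cases "d z \<ge> 0")
    case True
    then show ?thesis
      using d0 neg \<open>x \<in> X\<close> fin by (simp add: sum_nonneg_eq_0_iff)
  next
    case False
    have "(\<Sum>y\<in>X. - d y) = 0" using d0 by (simp add: sum_negf)
    then have "- d x = 0"
      using pos False \<open>x \<in> X\<close> fin by (subst (asm) sum_nonneg_eq_0_iff) auto
    then show ?thesis by simp
  qed
  then show ?thesis by (simp add: d_def)
qed

text \<open>For fixed \<open>s\<close> both double sums run over the \<open>y\<close> with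
  \<open>TX s (\<pi> y) = x'\<close>, grouped by \<open>\<pi> y\<close> on one side and by
  \<open>TY s y\<close> on the other.\<close>

lemma invariant_weight_pushforward:
  assumes fin: "finite X" "finite Y" and TY: "\<And>s. s \<in> I \<Longrightarrow> TY s ` Y \<subseteq> Y"
    and \<pi>: "\<pi> ` Y \<subseteq> X" and comm: "\<And>s y. s \<in> I \<Longrightarrow> y \<in> Y \<Longrightarrow> \<pi> (TY s y) = TX s (\<pi> y)"
    and inv: "invariant_weight I TY Y \<nu>"
  shows "invariant_weight I TX X (\<lambda>x. \<Sum>y | y \<in> Y \<and> \<pi> y = x. \<nu> y)"
  unfolding invariant_weight_def
proof
  fix x' assume "x' \<in> X"
  have "(\<Sum>x | x \<in> X \<and> TX s x = x'. \<Sum>y | y \<in> Y \<and> \<pi> y = x. \<nu> y)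
      = (\<Sum>y' | y' \<in> Y \<and> \<pi> y' = x'. \<Sum>y | y \<in> Y \<and> TY s y = y'. \<nu> y)" if "s \<in> I" for s
  proof -
    let ?Z = "{y \<in> Y. TX s (\<pi> y) = x'}"
    have "(\<Sum>x | x \<in> X \<and> TX s x = x'. \<Sum>y | y \<in> Y \<and> \<pi> y = x. \<nu> y)
        = (\<Sum>x | x \<in> X \<and> TX s x = x'. \<Sum>y | y \<in> ?Z \<and> \<pi> y = x. \<nu> y)"
      by (intro sum.cong) auto
    also have "\<dots> = sum \<nu> ?Z"
      using fin \<pi> by (intro sum_fibres) auto
    also have "\<dots> = (\<Sum>y' | y' \<in> Y \<and> \<pi> y' = x'. \<Sum>y | y \<in> ?Z \<and> TY s y = y'. \<nu> y)"
      using fin TY[OF that] comm[OF that] by (intro sum_fibres[symmetric]) auto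
    also have "\<dots> = (\<Sum>y' | y' \<in> Y \<and> \<pi> y' = x'. \<Sum>y | y \<in> Y \<and> TY s y = y'. \<nu> y)"
      using comm[OF that] by (intro sum.cong) auto
    finally show ?thesis .
  qed
  then have "(\<Sum>s\<in>I. \<Sum>x | x \<in> X \<and> TX s x = x'. \<Sum>y | y \<in> Y \<and> \<pi> y = x. \<nu> y)
      = (\<Sum>s\<in>I. \<Sum>y' | y' \<in> Y \<and> \<pi> y' = x'. \<Sum>y | y \<in> Y \<and> TY s y = y'. \<nu> y)"
    by simp
  also have "\<dots> = (\<Sum>y' | y' \<in> Y \<and> \<pi> y' = x'. \<Sum>s\<in>I. \<Sum>y | y \<in> Y \<and> TY s y = y'. \<nu> y)"
    by (rule sum.swap)
  also have "\<dots> = (\<Sum>y' | y' \<in> Y \<and> \<pi> y' = x'. real (card I) * \<nu> y')"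
    using inv by (intro sum.cong) (auto simp: invariant_weight_def)
  finally show "(\<Sum>s\<in>I. \<Sum>x | x \<in> X \<and> TX s x = x'. \<Sum>y | y \<in> Y \<and> \<pi> y = x. \<nu> y)
      = real (card I) * (\<Sum>y | y \<in> Y \<and> \<pi> y = x'. \<nu> y)"
    by (simp add: sum_distrib_left)
qed

text \<open>The first component of \<open>\<Phi>\<close> keeps the information that \<open>T\<close>
  loses. An injective self-map of the finite set \<open>I \<times> X\<close> is a permutation, so
  exactly \<open>card I\<close> pairs lead to each \<open>y\<close>.\<close>

lemma invariant_weight_uniform:
  assumes fin: "finite X" "finite I" and inj: "inj_on \<Phi> (I \<times> X)"
    and into: "\<And>s x. s \<in> I \<Longrightarrow> x \<in> X \<Longrightarrow> fst (\<Phi> (s, x)) \<in> I \<and> snd (\<Phi> (s, x)) = T s x"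
    and T: "\<And>s x. s \<in> I \<Longrightarrow> x \<in> X \<Longrightarrow> T s x \<in> X"
  shows "invariant_weight I T X (\<lambda>_. 1)"
  unfolding invariant_weight_def
proof
  fix y assume y: "y \<in> X"
  have "\<Phi> ` (I \<times> X) \<subseteq> I \<times> X"
  proof
    fix v assume "v \<in> \<Phi> ` (I \<times> X)"
    then obtain s x where "s \<in> I" "x \<in> X" "v = \<Phi> (s, x)" by auto
    then show "v \<in> I \<times> X" using into[of s x] T[of s x] by (simp add: mem_Times_iff)
  qed
  then have img: "\<Phi> ` (I \<times> X) = I \<times> X"
    using inj fin by (simp add: endo_inj_surj)
  let ?P = "SIGMA s:I. {x \<in> X. T s x = y}"
  have "\<Phi> ` ?P = I \<times> {y}"
  proof
    show "\<Phi> ` ?P \<subseteq> I \<times> {y}"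
    proof
      fix v assume "v \<in> \<Phi> ` ?P"
      then obtain s x where "s \<in> I" "x \<in> X" "T s x = y" "v = \<Phi> (s, x)" by auto
      then show "v \<in> I \<times> {y}" using into[of s x] by (simp add: mem_Times_iff)
    qed
    show "I \<times> {y} \<subseteq> \<Phi> ` ?P"
    proof
      fix v assume v: "v \<in> I \<times> {y}"
      then have "v \<in> \<Phi> ` (I \<times> X)" using img y by auto
      then obtain s x where "s \<in> I" "x \<in> X" "v = \<Phi> (s, x)" by auto
      then show "v \<in> \<Phi> ` ?P" using into[of s x] v by auto
    qed
  qed
  moreover have "inj_on \<Phi> ?P" by (rule inj_on_subset[OF inj]) auto
  ultimately have "card ?P = card (I \<times> {y})" using card_image[of \<Phi> ?P] by simp
  then have "(\<Sum>s\<in>I. card {x \<in> X. T s x = y}) = card I"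
    using fin by simp
  then have "(\<Sum>s\<in>I. real (card {x \<in> X. T s x = y})) = real (card I)"
    unfolding of_nat_sum[symmetric] by simp
  then show "(\<Sum>s\<in>I. \<Sum>x | x \<in> X \<and> T s x = y. 1) = real (card I) * 1"
    by simp
qed

subsection \<open>Multiline configurations and bells\<close>

locale site_ring =
  fixes n :: nat
  assumes two_le_n: "2 \<le> n"
begin

abbreviation left :: "nat \<Rightarrow> nat" where "left \<equiv> left_site n"
definition sites :: "nat set" where "sites = {1..n}"

lemma finite_sites [simp]: "finite sites"
  by (simp add: sites_def)

lemma card_sites [simp]: "card sites = n"
  by (simp add: sites_def)

lemma left_in_sites: "s \<in> sites \<Longrightarrow> left s \<in> sites"
  by (auto simp: left_site_def sites_def)

lemma left_neq: "s \<in> sites \<Longrightarrow> left s \<noteq> s"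
  using two_le_n by (auto simp: left_site_def sites_def)

lemma left_inj: "inj_on left sites"
  by (auto simp: inj_on_def left_site_def sites_def split: if_splits)

lemma left_eq_iff: "s \<in> sites \<Longrightarrow> r \<in> sites \<Longrightarrow> left s = left r \<longleftrightarrow> s = r"
  using left_inj by (auto simp: inj_on_def)

lemma left_image: "left ` sites = sites"
  using left_inj left_in_sites by (intro endo_inj_surj) auto

lemma left_bij: "bij_betw left sites sites"
  using left_inj left_image by (simp add: bij_betw_def)

definition jump :: "nat \<Rightarrow> nat set \<Rightarrow> nat set" where
  "jump s A = (if s \<in> A \<and> left s \<notin> A then insert (left s) (A - {s}) else A)"

lemma mem_jump:
  assumes "s \<in> sites"
  shows "x \<in> jump s A \<longleftrightarrow>
    (if x = left s then s \<in> A \<or> left s \<in> A else if x = s then s \<in> A \<and> left s \<in> A else x \<in> A)"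
  using left_neq[OF assms] by (auto simp: jump_def)

lemma jump_mono: "s \<in> sites \<Longrightarrow> A \<subseteq> B \<Longrightarrow> jump s A \<subseteq> jump s B"
  by (auto simp: mem_jump subset_iff)

definition lines :: "nat \<Rightarrow> nat set set" where
  "lines k = {A. A \<subseteq> sites \<and> card A = k}"

lemma finite_lines: "finite (lines k)"
  by (rule finite_subset[of _ "Pow sites"]) (auto simp: lines_def)

lemma card_lines: "card (lines k) = n choose k"
  using n_subsets[of sites k] by (simp add: lines_def)

lemma jump_lines:
  assumes "s \<in> sites" "A \<in> lines k"
  shows "jump s A \<in> lines k"
proof -
  have fin: "finite A" using assms by (auto simp: lines_def intro: finite_subset)
  have "card (insert (left s) (A - {s})) = card A" if "s \<in> A" "left s \<notin> A"
    using fin that card_Suc_Diff1[OF fin that(1)] by simp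
  then show ?thesis
    using assms left_in_sites[OF assms(1)] by (auto simp: lines_def jump_def)
qed

definition exits :: "nat set \<Rightarrow> nat set" where
  "exits S = {s \<in> sites. left s \<in> S \<and> s \<notin> S}"

definition entries :: "nat set \<Rightarrow> nat set" where
  "entries S = {s \<in> sites. s \<in> S \<and> left s \<notin> S}"

text \<open>Counting \<open>S\<close> by \<open>s\<close> and, after rotation, by
  \<open>left s\<close>, the sites with both \<open>s\<close> and \<open>left s\<close> in
  \<open>S\<close> are common to the two counts; what remains are the entries and the exits.\<close>

lemma card_exits_entries:
  assumes "S \<subseteq> sites"
  shows "card (exits S) = card (entries S)"
proof -
  let ?both = "{s \<in> sites. s \<in> S \<and> left s \<in> S}"
  have "left ` {s \<in> sites. left s \<in> S} = S \<inter> left ` sites" by auto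
  then have "left ` {s \<in> sites. left s \<in> S} = S"
    using left_image assms by auto
  then have "card S = card {s \<in> sites. left s \<in> S}"
    using card_image[OF inj_on_subset[OF left_inj], of "{s \<in> sites. left s \<in> S}"] by auto
  also have "{s \<in> sites. left s \<in> S} = ?both \<union> exits S"
    by (auto simp: exits_def)
  also have "card \<dots> = card ?both + card (exits S)"
    by (intro card_Un_disjoint) (auto simp: exits_def)
  finally have "card S = card ?both + card (exits S)" .
  moreover have "card (?both \<union> entries S) = card ?both + card (entries S)"
    by (intro card_Un_disjoint) (auto simp: entries_def)
  moreover have "?both \<union> entries S = S"
    using assms by (auto simp: entries_def)
  ultimately show ?thesis by simp
qed

text \<open>
  The bell that line \<open>S\<close> passes to the line above it when it is hit by a bell at \<open>s\<close>.  Rerouting the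
  exits to the entries makes \<open>(s, S) \<mapsto> (bell S s, jump s S)\<close> injective, and moving an arrival
  backwards across an entry of \<open>S\<close> leaves the departures unchanged.
\<close>

definition bell :: "nat set \<Rightarrow> nat \<Rightarrow> nat" where
  "bell S s = (if s \<in> exits S then (SOME f. bij_betw f (exits S) (entries S)) s else s)"

lemma bell_bij:
  assumes "S \<subseteq> sites"
  shows "bij_betw (bell S) (exits S) (entries S)"
proof -
  have "\<exists>f. bij_betw f (exits S) (entries S)"
    using card_exits_entries[OF assms]
    by (intro finite_same_card_bij) (auto simp: exits_def entries_def)
  then have "bij_betw (SOME f. bij_betw f (exits S) (entries S)) (exits S) (entries S)"
    by (rule someI_ex)
  then show ?thesis
    by (rule bij_betw_cong[THEN iffD1, rotated]) (simp add: bell_def)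
qed

lemma bell_exits: "S \<subseteq> sites \<Longrightarrow> s \<in> exits S \<Longrightarrow> bell S s \<in> entries S"
  using bell_bij bij_betwE by blast

lemma bell_not_exits: "s \<notin> exits S \<Longrightarrow> bell S s = s"
  by (simp add: bell_def)

lemma bell_in_sites: "S \<subseteq> sites \<Longrightarrow> s \<in> sites \<Longrightarrow> bell S s \<in> sites"
  using bell_exits[of S s] bell_not_exits[of s S] by (cases "s \<in> exits S") (auto simp: entries_def)

lemma jump_exits: "s \<in> exits S \<Longrightarrow> jump s S = S"
  by (auto simp: exits_def jump_def)

lemma jump_not_entry: "s \<in> sites \<Longrightarrow> s \<notin> entries (jump s S)"
  using left_neq by (auto simp: entries_def mem_jump)

text \<open>After a ring, \<open>left s\<close> occupied and \<open>s\<close> empty can come from a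
  genuine jump or from an exit that stayed put; with exits excluded the jump is reversible.\<close>

lemma jump_cancel:
  assumes "s \<in> sites" "s \<notin> exits S" "s \<notin> exits R" "jump s S = jump s R"
  shows "S = R"
proof (rule set_eqI)
  fix x
  have "y \<in> jump s S \<longleftrightarrow> y \<in> jump s R" for y using assms(4) by simp
  from this[of x] this[of s] this[of "left s"] show "x \<in> S \<longleftrightarrow> x \<in> R"
    using assms(1-3) left_neq[OF assms(1)] left_in_sites[OF assms(1)]
    by (auto simp: mem_jump exits_def split: if_splits)
qed

text \<open>The image reveals the branch: a rerouted bell is an entry of the resulting line, whereas
  a bell passed on unchanged never is. Within a branch, the bijection or \<open>jump_cancel\<close>
  finishes.\<close>

lemma bell_jump_inj:
  assumes "s \<in> sites" "r \<in> sites" "S \<subseteq> sites" "R \<subseteq> sites"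
    and b: "bell S s = bell R r" and j: "jump s S = jump r R"
  shows "s = r \<and> S = R"
proof (cases "s \<in> exits S")
  case s: True
  show ?thesis
  proof (cases "r \<in> exits R")
    case True
    then have "S = R" using s j by (simp add: jump_exits)
    then show ?thesis
      using bell_bij[of S] b s True assms by (auto simp: bij_betw_def inj_on_def)
  next
    case False
    then show ?thesis
      using bell_exits[of S s] jump_not_entry[of r R] jump_exits[OF s] assms s
      by (simp add: bell_not_exits)
  qed
next
  case s: False
  show ?thesis
  proof (cases "r \<in> exits R")
    case True
    then show ?thesis
      using bell_exits[of R r] jump_not_entry[of s S] jump_exits[OF True] assms s
      by (simp add: bell_not_exits)
  next
    case False
    then show ?thesis
      using s b j jump_cancel[of s S R] assms by (simp add: bell_not_exits)
  qed
qed

definition multiline :: "nat \<Rightarrow> nat \<Rightarrow> nat \<Rightarrow> (nat set \<times> nat set \<times> nat set) set" where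
  "multiline a b c = lines a \<times> lines b \<times> lines c"

text \<open>The clock rings at the bottom line \<open>C\<close> and the bell travels upwards; the
  bell that leaves \<open>A\<close> is discarded here and kept only in the injectivity
  argument.\<close>

definition multiline_ring ::
    "nat \<Rightarrow> nat set \<times> nat set \<times> nat set \<Rightarrow> nat set \<times> nat set \<times> nat set" where
  "multiline_ring s = (\<lambda>(A, B, C).
     (jump (bell B (bell C s)) A, jump (bell C s) B, jump s C))"

lemma finite_multiline: "finite (multiline a b c)"
  by (simp add: multiline_def finite_lines)

lemma card_multiline: "card (multiline a b c) = (n choose a) * (n choose b) * (n choose c)"
  by (simp add: multiline_def card_cartesian_product card_lines)

lemma multiline_ring_in:
  "s \<in> sites \<Longrightarrow> x \<in> multiline a b c \<Longrightarrow> multiline_ring s x \<in> multiline a b c"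
  by (auto simp: multiline_def multiline_ring_def intro!: jump_lines bell_in_sites)
     (auto simp: lines_def)

lemma multiline_uniform_invariant:
  "invariant_weight sites multiline_ring (multiline a b c) (\<lambda>_. 1)"
proof (rule invariant_weight_uniform)
  let ?\<Phi> = "\<lambda>(s, x). (case x of (A, B, C) \<Rightarrow> bell A (bell B (bell C s)), multiline_ring s x)"
  have sub: "A \<subseteq> sites" if "A \<in> lines k" for A k
    using that by (simp add: lines_def)
  show "inj_on ?\<Phi> (sites \<times> multiline a b c)"
  proof (rule inj_onI, clarify)
    fix s A B C s' A' B' C'
    assume s: "s \<in> sites" "s' \<in> sites"
      and m: "(A, B, C) \<in> multiline a b c" "(A', B', C') \<in> multiline a b c"
      and eq: "bell A (bell B (bell C s)) = bell A' (bell B' (bell C' s'))"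
        "multiline_ring s (A, B, C) = multiline_ring s' (A', B', C')"
    have sb: "A \<subseteq> sites" "B \<subseteq> sites" "C \<subseteq> sites" "A' \<subseteq> sites" "B' \<subseteq> sites" "C' \<subseteq> sites"
      using m sub by (auto simp: multiline_def)
    \<comment> \<open>Decoding starts at the top: the new line \<open>A\<close> and its outgoing
      bell determine the incoming bell, which is the outgoing bell of the line below.\<close>
    have A: "bell B (bell C s) = bell B' (bell C' s') \<and> A = A'"
      using eq s sb by (intro bell_jump_inj) (auto simp: multiline_ring_def intro!: bell_in_sites)
    then have B: "bell C s = bell C' s' \<and> B = B'"
      using eq s sb by (intro bell_jump_inj) (auto simp: multiline_ring_def intro!: bell_in_sites)
    then have "s = s' \<and> C = C'"
      using eq s sb by (intro bell_jump_inj) (auto simp: multiline_ring_def)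
    with A B show "s = s' \<and> (A, B, C) = (A', B', C')" by simp
  qed
  show "fst (?\<Phi> (s, x)) \<in> sites \<and> snd (?\<Phi> (s, x)) = multiline_ring s x"
    if "s \<in> sites" "x \<in> multiline a b c" for s x
    using that sub by (cases x) (auto simp: multiline_def intro!: bell_in_sites)
qed (use multiline_ring_in finite_multiline in auto)

subsection \<open>Queues on the ring\<close>

lemma funpow_left:
  assumes "x \<in> sites" "i \<le> n"
  shows "(left ^^ i) x = (if i < x then x - i else n + x - i)"
  using assms(2)
proof (induction i)
  case (Suc i)
  then show ?case
    using assms(1) two_le_n by (auto simp: left_site_def sites_def)
qed (use assms(1) in \<open>auto simp: sites_def\<close>)

lemma orbit_bij:
  assumes "x \<in> sites"
  shows "bij_betw (\<lambda>i. (left ^^ i) x) {..<n} sites"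
proof -
  have "inj_on (\<lambda>i. (left ^^ i) x) {..<n}"
    using assms by (auto simp: inj_on_def funpow_left sites_def split: if_splits)
  moreover have "(\<lambda>i. (left ^^ i) x) ` {..<n} \<subseteq> sites"
    using assms by (auto simp: funpow_left sites_def)
  ultimately show ?thesis
    unfolding bij_betw_def by (metis card_image card_lessThan card_sites card_subset_eq finite_sites)
qed

definition load :: "nat set \<Rightarrow> nat set \<Rightarrow> nat \<Rightarrow> nat \<Rightarrow> int" where
  "load A S l x = (\<Sum>i<l. of_bool ((left ^^ i) x \<in> A) - of_bool ((left ^^ i) x \<in> S))"

lemma load_0 [simp]: "load A S 0 x = 0"
  by (simp add: load_def)

lemma load_Suc:
  "load A S (Suc l) x = of_bool (x \<in> A) - of_bool (x \<in> S) + load A S l (left x)"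
  unfolding load_def sum.lessThan_Suc_shift by (simp add: funpow_swap1)

lemma sum_of_bool_sites: "A \<subseteq> sites \<Longrightarrow> (\<Sum>x\<in>sites. of_bool (x \<in> A)) = (int (card A))"
  by (simp add: of_bool_def sum.If_cases Int_absorb1)

lemma load_full:
  assumes "x \<in> sites" "A \<subseteq> sites" "S \<subseteq> sites"
  shows "load A S n x = int (card A) - int (card S)"
proof -
  have "load A S n x = (\<Sum>y\<in>sites. of_bool (y \<in> A) - of_bool (y \<in> S))"
    unfolding load_def by (rule sum.reindex_bij_betw[OF orbit_bij[OF assms(1)]])
  then show ?thesis using assms by (simp add: sum_subtractf sum_of_bool_sites Int_absorb1)
qed

text \<open>
  A line \<open>A\<close> of arrivals and a line \<open>S\<close> of services form a discrete queue in which time runs from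
  left to right around the ring; \<open>load A S l x\<close> is the surplus of arrivals over services among the
  \<open>l\<close> sites ending at \<open>x\<close>.
\<close>

definition unused :: "nat set \<Rightarrow> nat set \<Rightarrow> nat set" where
  "unused A S = {x \<in> sites. \<forall>l\<in>{1..n}. load A S l x < 0}"

definition departures :: "nat set \<Rightarrow> nat set \<Rightarrow> nat set" where
  "departures A S = S - unused A S"

text \<open>The truncated subtraction in the queue length recursion is intended.\<close>

definition is_queue :: "nat set \<Rightarrow> nat set \<Rightarrow> (nat \<Rightarrow> nat) \<Rightarrow> bool" where
  "is_queue A S q \<longleftrightarrow> (\<forall>x\<in>sites. q x = q (left x) + of_bool (x \<in> A) - of_bool (x \<in> S))"

definition idle :: "nat set \<Rightarrow> nat set \<Rightarrow> (nat \<Rightarrow> nat) \<Rightarrow> nat set" where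
  "idle A S q = {x \<in> S. x \<notin> A \<and> q (left x) = 0}"

lemma unused_iff_Suc:
  "x \<in> unused A S \<longleftrightarrow>
     x \<in> sites \<and> (\<forall>l<n. of_bool (x \<in> A) - of_bool (x \<in> S) + load A S l (left x) < 0)"
proof -
  have "(\<forall>l\<in>{1..n}. load A S l x < 0) \<longleftrightarrow> (\<forall>l<n. load A S (Suc l) x < 0)"
    by (metis One_nat_def Suc_le_D Suc_le_eq Suc_le_mono atLeastAtMost_iff le0)
  then show ?thesis by (simp add: unused_def load_Suc)
qed

text \<open>The queue length at \<open>x\<close> is taken to be the largest load of a window ending
  at \<open>x\<close>, the empty window included.\<close>

lemma queue_exists:
  assumes A: "A \<subseteq> sites" and S: "S \<subseteq> sites" and le: "card A \<le> card S"
  obtains q where "is_queue A S q" "idle A S q = unused A S"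
proof -
  define M where "M x = Max ((\<lambda>l. load A S l x) ` {..<n})" for x
  define c where "c x = (of_bool (x \<in> A) - of_bool (x \<in> S) :: int)" for x
  have "0 \<in> {..<n}" using two_le_n by simp
  then have ne: "{..<n} \<noteq> {}" by blast
  have M0: "M x \<ge> 0" for x
  proof -
    have "load A S 0 x \<le> M x"
      unfolding M_def using two_le_n by (intro Max_ge imageI) auto
    then show ?thesis by simp
  qed
  have rec: "M x = max 0 (c x + M (left x))" if x: "x \<in> sites" for x
  proof -
    \<comment> \<open>A full turn has load at most 0, so length \<open>n\<close> may join the
      maximum; this is what lets windows ending at \<open>left x\<close> be extended to
      \<open>x\<close>.\<close>
    have "load A S n x \<le> M x"
      using load_full[OF x A S] le M0[of x] by simp
    moreover have "{..n} = insert n {..<n}" by auto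
    ultimately have "M x = Max ((\<lambda>l. load A S l x) ` {..n})"
      using ne by (simp add: M_def)
    also have "{..n} = insert 0 (Suc ` {..<n})"
      using lessThan_Suc_atMost lessThan_Suc_eq_insert_0 by metis
    also have "Max ((\<lambda>l. load A S l x) ` \<dots>) = max 0 (Max ((\<lambda>l. load A S l (left x) + c x) ` {..<n}))"
      using ne by (simp add: image_image load_Suc c_def add.commute)
    also have "Max ((\<lambda>l. load A S l (left x) + c x) ` {..<n}) = M (left x) + c x"
      using ne unfolding M_def by (intro Max_add_commute) auto
    finally show ?thesis by (simp add: add.commute)
  qed
  have un: "x \<in> unused A S \<longleftrightarrow> x \<in> sites \<and> c x + M (left x) < 0" for x
  proof -
    have "M (left x) < - c x \<longleftrightarrow> (\<forall>l<n. load A S l (left x) < - c x)"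
      using ne by (auto simp: M_def)
    then show ?thesis
      unfolding unused_iff_Suc by (simp add: c_def algebra_simps)
  qed
  have "is_queue A S (\<lambda>x. nat (M x))"
    unfolding is_queue_def
  proof
    fix x assume x: "x \<in> sites"
    show "nat (M x) = nat (M (left x)) + of_bool (x \<in> A) - of_bool (x \<in> S)"
      using rec[OF x] M0[of "left x"] by (auto simp: c_def)
  qed
  moreover have "idle A S (\<lambda>x. nat (M x)) = unused A S"
  proof (rule set_eqI)
    fix x
    show "x \<in> idle A S (\<lambda>x. nat (M x)) \<longleftrightarrow> x \<in> unused A S"
      using M0[of "left x"] S by (cases "x \<in> A"; cases "x \<in> S") (auto simp: un idle_def c_def)
  qed
  ultimately show thesis using that by blast
qed

text \<open>Summed around the ring the queue lengths cancel, and the truncated subtraction gains one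
  unit exactly at each idle service.\<close>

lemma card_idle:
  assumes A: "A \<subseteq> sites" and S: "S \<subseteq> sites" and q: "is_queue A S q"
  shows "card (idle A S q) + card A = card S"
proof -
  have I: "idle A S q \<subseteq> sites" using S by (auto simp: idle_def)
  have "(\<Sum>x\<in>sites. int (q (left x))) = (\<Sum>x\<in>sites. int (q x))"
    by (rule sum.reindex_bij_betw[OF left_bij])
  also have "\<dots> = (\<Sum>x\<in>sites. int (q (left x)) + of_bool (x \<in> A) - of_bool (x \<in> S)
                              + of_bool (x \<in> idle A S q))"
    using q S by (intro sum.cong refl) (auto simp: is_queue_def idle_def of_bool_def)
  also have "\<dots> = (\<Sum>x\<in>sites. int (q (left x))) + int (card A) - int (card S) + int (card (idle A S q))"
    using A S I by (simp add: sum.distrib sum_subtractf sum_of_bool_sites Int_absorb1)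
  finally show ?thesis by linarith
qed

text \<open>
  The pointwise maximum of two queues is again a queue, and a larger queue idles less; since the
  number of idle services does not depend on the queue, neither does the idle set.
\<close>

lemma idle_unique:
  assumes A: "A \<subseteq> sites" and S: "S \<subseteq> sites" and q: "is_queue A S q" "is_queue A S r"
  shows "idle A S q = idle A S r"
proof -
  let ?m = "\<lambda>x. max (q x) (r x)"
  have m: "is_queue A S ?m"
    using q unfolding is_queue_def
    by (metis (no_types, lifting) diff_le_mono max_absorb1 max_absorb2 add_le_mono1 nat_le_linear)
  have fin: "finite S" using S finite_subset[OF _ finite_sites] by blast
  have "idle A S ?m = idle A S f" if f: "is_queue A S f" "\<And>x. f x \<le> ?m x" for f
  proof (rule card_subset_eq)
    show "finite (idle A S f)" using fin by (simp add: idle_def)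
    show "idle A S ?m \<subseteq> idle A S f"
    proof
      fix x assume "x \<in> idle A S ?m"
      then show "x \<in> idle A S f" using f(2)[of "left x"] by (simp add: idle_def)
    qed
    show "card (idle A S ?m) = card (idle A S f)"
      using card_idle[OF A S m] card_idle[OF A S f(1)] by simp
  qed
  then show ?thesis using q by (metis max.cobounded1 max.cobounded2)
qed

text \<open>Frees the departures from the maximal-load solution: any solution of the recursion, in
  particular a locally modified one, computes them.\<close>

lemma departures_queue:
  assumes A: "A \<subseteq> sites" and S: "S \<subseteq> sites" and q: "is_queue A S q"
  shows "departures A S = S - idle A S q"
proof -
  have "card A \<le> card S" using card_idle[OF assms] by simp
  from queue_exists[OF A S this] obtain r where "is_queue A S r" "idle A S r = unused A S" .
  then show ?thesis using idle_unique[OF A S q] by (simp add: departures_def)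
qed

lemma departures_subset: "departures A S \<subseteq> S"
  by (auto simp: departures_def)

lemma departures_lines:
  assumes "A \<in> lines a" "S \<in> lines b" "a \<le> b"
  shows "departures A S \<in> lines a"
proof -
  have A: "A \<subseteq> sites" "card A = a" and S: "S \<subseteq> sites" "card S = b"
    using assms by (auto simp: lines_def)
  with assms obtain q where q: "is_queue A S q" "idle A S q = unused A S"
    using queue_exists[OF A(1) S(1)] by auto
  have "finite S" using S finite_subset[OF _ finite_sites] by blast
  moreover have "idle A S q \<subseteq> S" by (auto simp: idle_def)
  ultimately have "card (S - idle A S q) = card S - card (idle A S q)"
    by (meson card_Diff_subset finite_subset)
  then have "card (departures A S) = a"
    using card_idle[OF A(1) S(1) q(1)] A S departures_queue[OF A(1) S(1) q(1)] by simp
  then show ?thesis using departures_subset S by (auto simp: lines_def)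
qed

lemma load_mono: "A \<subseteq> B \<Longrightarrow> load A S l x \<le> load B S l x"
  unfolding load_def by (intro sum_mono) auto

lemma unused_antimono: "A \<subseteq> B \<Longrightarrow> unused B S \<subseteq> unused A S"
  unfolding unused_def using load_mono[of A B S] by (blast intro: le_less_trans)

lemma departures_mono: "A \<subseteq> B \<Longrightarrow> departures A S \<subseteq> departures B S"
  using unused_antimono[of A B S] by (auto simp: departures_def)

text \<open>Moving arrivals or services from \<open>t\<close> to \<open>left t\<close> changes the
  queue length at \<open>left t\<close> only, so \<open>q'\<close> recomputes that single value and
  agrees with \<open>q\<close> from \<open>t\<close> on.\<close>

lemma departures_jump:
  assumes A: "A \<subseteq> sites" and S: "S \<subseteq> sites" and le: "card A \<le> card S" and s: "s \<in> sites"
  shows "departures (jump (bell S s) A) (jump s S) = jump s (departures A S)"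
proof -
  obtain q where q: "is_queue A S q" using queue_exists[OF A S le] .
  define t where "t = bell S s"
  have t: "t \<in> sites" unfolding t_def by (rule bell_in_sites[OF S s])
  define A' where "A' = jump t A"
  define S' where "S' = jump s S"
  have A': "A' \<subseteq> sites" and S': "S' \<subseteq> sites"
    using jump_lines[OF t, of A] jump_lines[OF s, of S] A S
    by (auto simp: A'_def S'_def lines_def)
  define q' where
    "q' = q(left t := q (left (left t)) + of_bool (left t \<in> A') - of_bool (left t \<in> S'))"
  note ltn = left_neq[OF t] left_neq[OF left_in_sites[OF t]] left_in_sites[OF t]
  have qt: "q t = q (left t) + of_bool (t \<in> A) - of_bool (t \<in> S)"
    and qlt: "q (left t) = q (left (left t)) + of_bool (left t \<in> A) - of_bool (left t \<in> S)"
    using q t ltn by (auto simp: is_queue_def)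
  have mA: "x \<in> A' \<longleftrightarrow> (if x = left t then t \<in> A \<or> left t \<in> A
      else if x = t then t \<in> A \<and> left t \<in> A else x \<in> A)" for x
    unfolding A'_def by (rule mem_jump[OF t])
  have dep: "departures A S = S - idle A S q" by (rule departures_queue[OF A S q])
  consider (exit) "s \<in> exits S" | (stay) "s \<notin> exits S" by blast
  then show ?thesis
  proof cases
    case exit
    \<comment> \<open>Here \<open>t\<close> is an entry: an arrival moved to \<open>left t\<close>
      finds no service there and is still available for the service at \<open>t\<close>.\<close>
    have S'S: "S' = S" using exit by (simp add: S'_def jump_exits)
    have tS: "t \<in> S" "left t \<notin> S"
      using bell_exits[OF S exit] by (auto simp: t_def entries_def)
    have q': "is_queue A' S' q'"
      unfolding is_queue_def
    proof
      fix x assume x: "x \<in> sites"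
      show "q' x = q' (left x) + of_bool (x \<in> A') - of_bool (x \<in> S')"
        using q x t ltn tS S'S qt qlt left_eq_iff[OF x t]
        by (cases "x = left t"; cases "x = t") (auto simp: q'_def mA is_queue_def)
    qed
    have "idle A' S' q' = idle A S q"
    proof (rule set_eqI)
      fix x show "x \<in> idle A' S' q' \<longleftrightarrow> x \<in> idle A S q"
        using S t ltn tS S'S qt qlt left_eq_iff[of x t]
        by (cases "x = left t"; cases "x = t") (auto simp: q'_def mA idle_def)
    qed
    moreover have "jump s (departures A S) = departures A S"
      using exit departures_subset[of A S] by (auto simp: jump_def exits_def)
    ultimately show ?thesis
      using departures_queue[OF A' S' q'] dep S'S by (simp add: A'_def S'_def t_def)
  next
    case stay
    then have ts: "s = t" by (simp add: t_def bell_not_exits)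
    have mS: "x \<in> S' \<longleftrightarrow> (if x = left t then t \<in> S \<or> left t \<in> S
        else if x = t then t \<in> S \<and> left t \<in> S else x \<in> S)" for x
      unfolding S'_def using mem_jump[OF t] ts by simp
    \<comment> \<open>Excludes the harmful pattern, a service at \<open>left t\<close> and none at
      \<open>t\<close>, in which an arrival moved to \<open>left t\<close> could be served there at
      once.\<close>
    have nx: "left t \<in> S \<Longrightarrow> t \<in> S" using stay t by (auto simp: exits_def ts)
    have q': "is_queue A' S' q'"
      unfolding is_queue_def
    proof
      fix x assume x: "x \<in> sites"
      show "q' x = q' (left x) + of_bool (x \<in> A') - of_bool (x \<in> S')"
        using q x t ltn nx qt qlt left_eq_iff[OF x t]
        by (cases "x = left t"; cases "x = t") (auto simp: q'_def mA mS is_queue_def)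
    qed
    have "S' - idle A' S' q' = jump s (S - idle A S q)"
    proof (rule set_eqI)
      fix x show "x \<in> S' - idle A' S' q' \<longleftrightarrow> x \<in> jump s (S - idle A S q)"
        unfolding mem_jump[OF s]
        using S t ltn nx qt qlt left_eq_iff[of x t]
        by (cases "x = left t"; cases "x = t") (auto simp: q'_def mA mS idle_def ts)
    qed
    then show ?thesis
      using departures_queue[OF A' S' q'] dep by (simp add: A'_def S'_def t_def)
  qed
qed

end

subsection \<open>Ballot triples\<close>

text \<open>The lower index is an integer because the determinant shifts it below 0, where the value
  0 keeps Pascal's rule valid.\<close>

definition bin :: "nat \<Rightarrow> int \<Rightarrow> real" where
  "bin m k = (if k < 0 then 0 else real (m choose nat k))"

lemma bin_Suc: "bin (Suc m) k = bin m k + bin m (k - 1)"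
proof (cases "k > 0")
  case True
  then have "nat k = Suc (nat (k - 1))" by simp
  then show ?thesis using True by (simp add: bin_def)
qed (auto simp: bin_def)

lemma bin_absorb: "real (Suc m) * bin m (k - 1) = of_int k * bin (Suc m) k"
proof (cases "k > 0")
  case True
  then obtain j where k: "k = int (Suc j)" using zero_less_imp_eq_int by (metis gr0_conv_Suc of_nat_0_less_iff)
  have "real (Suc m * (m choose j)) = real (Suc j * (Suc m choose Suc j))"
    using Suc_times_binomial_eq[of m j] by (simp add: mult.commute)
  then show ?thesis by (simp add: k bin_def nat_add_distrib algebra_simps)
qed (auto simp: bin_def)

lemma bin_absorb': "real (Suc m) * bin m k = (real (Suc m) - of_int k) * bin (Suc m) k"
  using bin_absorb[of m k] bin_Suc[of m k] by (simp add: algebra_simps)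

text \<open>
  The Gessel-Viennot determinant with rows \<open>bin m (p + l)\<close>, \<open>bin m (q - 1 + l)\<close>, \<open>bin m (r - 2 + l)\<close>
  for \<open>l = 0, 1, 2\<close>, expanded along the first row.
\<close>

definition ballot_det :: "nat \<Rightarrow> int \<Rightarrow> int \<Rightarrow> int \<Rightarrow> real" where
  "ballot_det m p q r =
     bin m p * (bin m q * bin m r - bin m (q + 1) * bin m (r - 1))
   - bin m (p + 1) * (bin m (q - 1) * bin m r - bin m (q + 1) * bin m (r - 2))
   + bin m (p + 2) * (bin m (q - 1) * bin m (r - 1) - bin m q * bin m (r - 2))"

text \<open>By Pascal's rule each row is the sum of the rows at \<open>x\<close> and
  \<open>x - 1\<close> for \<open>m\<close>, and a determinant is linear in each of its three
  rows.\<close>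

lemma ballot_det_Suc:
  "ballot_det (Suc m) p q r =
     ballot_det m p q r + ballot_det m p q (r - 1)
   + ballot_det m p (q - 1) r + ballot_det m p (q - 1) (r - 1)
   + ballot_det m (p - 1) q r + ballot_det m (p - 1) q (r - 1)
   + ballot_det m (p - 1) (q - 1) r + ballot_det m (p - 1) (q - 1) (r - 1)"
proof -
  have e: "p + 1 - 1 = p" "p + 2 - 1 = p + 1" "q + 1 - 1 = q" "q - 1 - 1 = q - 2"
    "p - 1 + 1 = p" "p - 1 + 2 = p + 1" "q - 1 + 1 = q" "r - 1 - 1 = r - 2" "r - 2 - 1 = r - 3" "r - 1 - 2 = r - 3"
    by simp_all
  show ?thesis
    unfolding ballot_det_def bin_Suc e by algebra
qed

text \<open>Read from site \<open>n\<close> downwards, these are the words of the three-candidate ballot problem.\<close>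

definition ballot_triples :: "nat \<Rightarrow> nat \<Rightarrow> int \<Rightarrow> int \<Rightarrow> int \<Rightarrow> (nat set \<times> nat set \<times> nat set) set" where
  "ballot_triples n m p q r = {(A, B, C).
     A \<subseteq> {n - m<..n} \<and> B \<subseteq> {n - m<..n} \<and> C \<subseteq> {n - m<..n} \<and>
     int (card A) = r \<and> int (card B) = q \<and> int (card C) = p \<and>
     (\<forall>x. card (A \<inter> {x..}) \<le> card (B \<inter> {x..}) \<and> card (B \<inter> {x..}) \<le> card (C \<inter> {x..}))}"

lemma finite_ballot_triples: "finite (ballot_triples n m p q r)"
  by (rule finite_subset[of _ "Pow {n - m<..n} \<times> Pow {n - m<..n} \<times> Pow {n - m<..n}"])
     (auto simp: ballot_triples_def)

lemma ballot_triples_empty: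
  assumes "\<not> (r \<le> q \<and> q \<le> p)"
  shows "ballot_triples n m p q r = {}"
proof -
  have "r \<le> q \<and> q \<le> p" if "(A, B, C) \<in> ballot_triples n m p q r" for A B C
  proof -
    have "card (A \<inter> {0..}) \<le> card (B \<inter> {0..}) \<and> card (B \<inter> {0..}) \<le> card (C \<inter> {0..})"
      using that unfolding ballot_triples_def by blast
    then show ?thesis using that by (auto simp: ballot_triples_def)
  qed
  then show ?thesis using assms by fastforce
qed

definition add_if :: "bool \<Rightarrow> nat \<Rightarrow> nat set \<Rightarrow> nat set" where
  "add_if t y A = (if t then insert y A else A)"

lemma add_if_remove: "y \<in> A \<longleftrightarrow> t \<Longrightarrow> add_if t y (A - {y}) = A"
  by (auto simp: add_if_def)

lemma remove_add_if: "y \<notin> A \<Longrightarrow> add_if t y A - {y} = A"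
  by (auto simp: add_if_def)

lemma card_add_if: "finite A \<Longrightarrow> y \<notin> A \<Longrightarrow> card (add_if t y A) = card A + of_bool t"
  by (simp add: add_if_def)

lemma add_if_tail: "x > y \<Longrightarrow> add_if t y A \<inter> {x..} = A \<inter> {x..}"
  by (auto simp: add_if_def)

lemma card_split_bool3:
  fixes f g h :: "'a \<Rightarrow> bool"
  assumes "finite S"
  shows "card S = (\<Sum>t\<in>UNIV. \<Sum>u\<in>UNIV. \<Sum>v\<in>UNIV. card {x \<in> S. f x = t \<and> g x = u \<and> h x = v})"
proof -
  have "card S = (\<Sum>z\<in>UNIV. card {x \<in> S. (f x, g x, h x) = z})"
    using sum.group[OF assms, of "UNIV :: (bool \<times> bool \<times> bool) set" "\<lambda>x. (f x, g x, h x)" "\<lambda>_. 1::nat"]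
    by simp
  also have "\<dots> = (\<Sum>t\<in>UNIV. \<Sum>u\<in>UNIV. \<Sum>v\<in>UNIV. card {x \<in> S. f x = t \<and> g x = u \<and> h x = v})"
    unfolding sum.cartesian_product by (simp add: case_prod_unfold prod_eq_iff)
  finally show ?thesis .
qed

text \<open>Tails that start above \<open>n - m\<close> do not see this site; every other tail is a
  whole set, and the order of the whole sets is the hypothesis on \<open>r\<close>,
  \<open>q\<close>, \<open>p\<close>.\<close>

lemma card_ballot_triples_fibre:
  assumes m: "m < n" and ord: "r \<le> q" "q \<le> p"
  shows "card {z \<in> ballot_triples n (Suc m) p q r.
      (n - m \<in> fst z) = t \<and> (n - m \<in> fst (snd z)) = u \<and> (n - m \<in> snd (snd z)) = v}
    = card (ballot_triples n m (p - of_bool v) (q - of_bool u) (r - of_bool t))"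
    (is "card ?L = card ?R")
proof -
  define y where "y = n - m"
  have Sm: "{n - Suc m<..n} = insert y {y<..n}" using m by (auto simp: y_def)
  let ?f = "\<lambda>(A, B, C). (A - {y}, B - {y}, C - {y})"
  let ?g = "\<lambda>(A, B, C). (add_if t y A, add_if u y B, add_if v y C)"
  have cd: "int (card (D - {y})) = int (card D) - of_bool (y \<in> D)" if "D \<subseteq> insert y {y<..n}" for D
    using finite_subset[OF that] card_Suc_Diff1[of D y] by (cases "y \<in> D") auto
  have "bij_betw ?f ?L ?R"
  proof (rule bij_betw_byWitness[where f'="?g"])
    show "\<forall>z\<in>?L. ?g (?f z) = z"
      by (auto simp: add_if_remove y_def)
    show "\<forall>z\<in>?R. ?f (?g z) = z"
      by (auto simp: ballot_triples_def y_def intro!: remove_add_if)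
    show "?f ` ?L \<subseteq> ?R"
    proof (rule image_subsetI)
      fix z assume "z \<in> ?L"
      moreover obtain A B C where zeq: "z = (A, B, C)" by (cases z)
      ultimately have z: "(A, B, C) \<in> ballot_triples n (Suc m) p q r"
        and tuv: "(y \<in> A) = t" "(y \<in> B) = u" "(y \<in> C) = v"
        by (simp_all add: y_def)
      have tail: "card ((A - {y}) \<inter> {x..}) \<le> card ((B - {y}) \<inter> {x..}) \<and>
          card ((B - {y}) \<inter> {x..}) \<le> card ((C - {y}) \<inter> {x..})" for x
      proof -
        have e: "(D - {y}) \<inter> {x..} = D \<inter> {max x (Suc y)..}" if "D \<subseteq> insert y {y<..n}" for D
          using that by auto
        show ?thesis using z e by (simp add: ballot_triples_def Sm)
      qed
      show "?f z \<in> ?R"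
        unfolding zeq using z tail tuv cd[of A] cd[of B] cd[of C]
        by (auto simp: ballot_triples_def Sm y_def[symmetric])
    qed
    show "?g ` ?R \<subseteq> ?L"
    proof (rule image_subsetI)
      fix z assume "z \<in> ?R"
      moreover obtain A B C where zeq: "z = (A, B, C)" by (cases z)
      ultimately have sub: "A \<subseteq> {y<..n}" "B \<subseteq> {y<..n}" "C \<subseteq> {y<..n}"
        and card: "int (card A) = r - of_bool t" "int (card B) = q - of_bool u" "int (card C) = p - of_bool v"
        and tl: "\<And>x. card (A \<inter> {x..}) \<le> card (B \<inter> {x..})" "\<And>x. card (B \<inter> {x..}) \<le> card (C \<inter> {x..})"
        by (auto simp: ballot_triples_def y_def)
      have fin: "finite A" "finite B" "finite C" "y \<notin> A" "y \<notin> B" "y \<notin> C"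
        using sub by (auto intro: finite_subset[OF _ finite_greaterThanAtMost])
      have cards: "int (card (add_if t y A)) = r" "int (card (add_if u y B)) = q"
          "int (card (add_if v y C)) = p"
        using card fin by (simp_all add: card_add_if)
      have tail: "card (add_if t y A \<inter> {x..}) \<le> card (add_if u y B \<inter> {x..}) \<and>
          card (add_if u y B \<inter> {x..}) \<le> card (add_if v y C \<inter> {x..})" for x
      proof (cases "x > y")
        case True
        then show ?thesis using tl by (simp add: add_if_tail)
      next
        case False
        have "add_if w y D \<inter> {x..} = add_if w y D" if "D \<subseteq> {y<..n}" for w D
          using False that by (auto simp: add_if_def)
        then show ?thesis using sub cards ord by simp
      qed
      show "?g z \<in> ?L"
        unfolding zeq using sub fin cards tail by (auto simp: ballot_triples_def Sm y_def[symmetric] add_if_def)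
    qed
  qed
  then show ?thesis by (rule bij_betw_same_card)
qed

text \<open>The range extends one step beyond \<open>r \<le> q \<le> p\<close>, as far as the
  eight-term recursion reaches from inside. On this extra layer two rows of the determinant
  coincide, and there are no triples.\<close>

lemma card_ballot_triples:
  assumes "m \<le> n" "q \<le> p + 1" "r \<le> q + 1"
  shows "real (card (ballot_triples n m p q r)) = ballot_det m p q r"
  using assms
proof (induction m arbitrary: p q r)
  case 0
  have "ballot_triples n 0 p q r = (if p = 0 \<and> q = 0 \<and> r = 0 then {({}, {}, {})} else {})"
    by (auto simp: ballot_triples_def)
  moreover have "bin 0 k = of_bool (k = 0)" for k
    by (auto simp: bin_def)
  ultimately show ?case
    using 0 by (auto simp: ballot_det_def)
next
  case (Suc m)
  show ?case
  proof (cases "r \<le> q \<and> q \<le> p")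
    case True
    have "real (card (ballot_triples n m (p - of_bool v) (q - of_bool u) (r - of_bool t)))
        = ballot_det m (p - of_bool v) (q - of_bool u) (r - of_bool t)" for t u v
      using Suc True by (intro Suc.IH) auto
    moreover have "card (ballot_triples n (Suc m) p q r)
      = (\<Sum>t\<in>UNIV. \<Sum>u\<in>UNIV. \<Sum>v\<in>UNIV.
           card (ballot_triples n m (p - of_bool v) (q - of_bool u) (r - of_bool t)))"
      using Suc True
      by (subst card_split_bool3[OF finite_ballot_triples, where f="\<lambda>z. n - m \<in> fst z"
            and g="\<lambda>z. n - m \<in> fst (snd z)" and h="\<lambda>z. n - m \<in> snd (snd z)"])
         (simp add: card_ballot_triples_fibre)
    ultimately have "real (card (ballot_triples n (Suc m) p q r))
      = (\<Sum>t\<in>UNIV. \<Sum>u\<in>UNIV. \<Sum>v\<in>UNIV.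
           ballot_det m (p - of_bool v) (q - of_bool u) (r - of_bool t))"
      by simp
    then show ?thesis
      by (simp add: ballot_det_Suc UNIV_bool)
  next
    case False
    then have "q = p + 1 \<or> r = q + 1" using Suc by auto
    then have "ballot_det (Suc m) p q r = 0"
      by (auto simp: ballot_det_def algebra_simps)
    then show ?thesis using ballot_triples_empty[OF False] by simp
  qed
qed

subsection \<open>Counting multiline configurations\<close>

context site_ring
begin

lemma load_last:
  assumes "l < n" "A \<subseteq> sites" "S \<subseteq> sites"
  shows "load A S l n = int (card (A \<inter> {Suc n - l..})) - int (card (S \<inter> {Suc n - l..}))"
proof -
  have n: "n \<in> sites" using two_le_n by (auto simp: sites_def)
  have bij: "bij_betw (\<lambda>i. n - i) {..<l} {Suc n - l..n}"
    by (rule bij_betw_byWitness[where f'="\<lambda>x. n - x"]) (use assms(1) in auto)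
  have "load A S l n = (\<Sum>i<l. of_bool (n - i \<in> A) - of_bool (n - i \<in> S))"
    unfolding load_def using assms(1) n by (intro sum.cong) (auto simp: funpow_left)
  also have "\<dots> = (\<Sum>x\<in>{Suc n - l..n}. of_bool (x \<in> A) - of_bool (x \<in> S))"
    by (rule sum.reindex_bij_betw[OF bij])
  also have "\<dots> = int (card ({Suc n - l..n} \<inter> A)) - int (card ({Suc n - l..n} \<inter> S))"
    by (simp add: sum_subtractf of_bool_def sum.If_cases)
  finally have "load A S l n = int (card ({Suc n - l..n} \<inter> A)) - int (card ({Suc n - l..n} \<inter> S))" .
  moreover have "{Suc n - l..n} \<inter> D = D \<inter> {Suc n - l..}" if "D \<subseteq> sites" for D
    using that by (auto simp: sites_def)
  ultimately show ?thesis using assms by simp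
qed

lemma all_tails_iff:
  assumes "A \<subseteq> sites" "S \<subseteq> sites" "k < n"
  shows "(\<forall>l\<le>k. load A S l n \<le> 0) \<longleftrightarrow> (\<forall>x>n - k. card (A \<inter> {x..}) \<le> card (S \<inter> {x..}))"
proof
  assume L: "\<forall>l\<le>k. load A S l n \<le> 0"
  show "\<forall>x>n - k. card (A \<inter> {x..}) \<le> card (S \<inter> {x..})"
  proof (intro allI impI)
    fix x assume x: "x > n - k"
    show "card (A \<inter> {x..}) \<le> card (S \<inter> {x..})"
    proof (cases "x \<le> n")
      case True
      then have "Suc n - x \<le> k" "Suc n - x < n" "Suc n - (Suc n - x) = x"
        using x assms(3) by auto
      then show ?thesis using L load_last[OF _ assms(1,2), of "Suc n - x"] by fastforce
    next
      case False
      then have "A \<inter> {x..} = {}" using assms by (auto simp: sites_def)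
      then show ?thesis by simp
    qed
  qed
next
  assume R: "\<forall>x>n - k. card (A \<inter> {x..}) \<le> card (S \<inter> {x..})"
  show "\<forall>l\<le>k. load A S l n \<le> 0"
  proof (intro allI impI)
    fix l assume "l \<le> k"
    then show "load A S l n \<le> 0"
      using R[rule_format, of "Suc n - l"] load_last[OF _ assms(1,2), of l] assms(3) by auto
  qed
qed

text \<open>Site 1 follows site \<open>n\<close>, and a window of at most \<open>n\<close> sites
  ending at 1 stops at 2, so the cyclic condition becomes a linear ballot condition on
  tails.\<close>

lemma one_unused_iff:
  assumes "A \<subseteq> sites" "S \<subseteq> sites"
  shows "1 \<in> unused A S \<longleftrightarrow> 1 \<in> S \<and> 1 \<notin> A \<and> (\<forall>x\<ge>2. card (A \<inter> {x..}) \<le> card (S \<inter> {x..}))"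
proof -
  have left1: "left 1 = n" and s1: "1 \<in> sites" using two_le_n by (auto simp: left_site_def sites_def)
  have eq: "1 \<in> unused A S \<longleftrightarrow> (\<forall>l<n. of_bool (1 \<in> A) - of_bool (1 \<in> S) + load A S l n < 0)"
    unfolding unused_iff_Suc left1 using s1 by simp
  have all: "(\<forall>l\<le>n - 1. load A S l n \<le> 0) \<longleftrightarrow> (\<forall>x\<ge>2. card (A \<inter> {x..}) \<le> card (S \<inter> {x..}))"
    using all_tails_iff[OF assms, of "n - 1"] two_le_n by (simp add: Suc_le_eq numeral_2_eq_2)
  have less1: "k < 1 \<longleftrightarrow> k \<le> 0" for k :: int by auto
  have lt: "l < n \<longleftrightarrow> l \<le> n - 1" for l using two_le_n by auto
  show ?thesis
  proof (cases "1 \<in> S \<and> 1 \<notin> A")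
    case True
    then show ?thesis unfolding eq all[symmetric] lt by (simp add: less1)
  next
    case False
    then have "\<not> (of_bool (1 \<in> A) - of_bool (1 \<in> S) + load A S 0 n < 0)" by auto
    then show ?thesis unfolding eq using False two_le_n by (metis less_le_trans pos2)
  qed
qed

text \<open>Without a service at 1, an arrival at 1 would still be waiting at 2. A window of at most
  \<open>n\<close> sites ending at 2 stops at 3, hence the tails from 3 on.\<close>

lemma two_unused_iff:
  assumes "A \<subseteq> sites" "S \<subseteq> sites" "1 \<notin> S" "2 \<in> S"
  shows "2 \<in> unused A S \<longleftrightarrow> 1 \<notin> A \<and> 2 \<notin> A \<and> (\<forall>x\<ge>3. card (A \<inter> {x..}) \<le> card (S \<inter> {x..}))"
proof -
  have l: "left 1 = n" "left 2 = 1" and s2: "2 \<in> sites"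
    using two_le_n by (auto simp: left_site_def sites_def)
  have eq: "2 \<in> unused A S \<longleftrightarrow> (\<forall>k<n. of_bool (2 \<in> A) - 1 + load A S k 1 < 0)"
    unfolding unused_iff_Suc l using s2 assms by simp
  also have "\<dots> \<longleftrightarrow> 2 \<notin> A \<and> (\<forall>k<n. load A S k 1 \<le> 0)"
  proof (cases "2 \<in> A")
    case True
    then have "\<not> (of_bool (2 \<in> A) - 1 + load A S 0 1 < 0)" by auto
    then show ?thesis using True two_le_n by (metis less_le_trans pos2)
  next
    case False
    have "k < 1 \<longleftrightarrow> k \<le> 0" for k :: int by auto
    then show ?thesis using False by simp
  qed
  also have "(\<forall>k<n. load A S k 1 \<le> 0) \<longleftrightarrow> (\<forall>k\<le>n - 2. load A S (Suc k) 1 \<le> 0)"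
  proof -
    have "k < n \<longleftrightarrow> k = 0 \<or> (\<exists>k'\<le>n - 2. k = Suc k')" for k
      using two_le_n by (cases k) auto
    then show ?thesis by (metis load_0 order_refl)
  qed
  also have "\<dots> \<longleftrightarrow> (\<forall>k\<le>n - 2. of_bool (1 \<in> A) + load A S k n \<le> 0)"
    using assms by (simp add: load_Suc l[unfolded One_nat_def])
  also have "\<dots> \<longleftrightarrow> 1 \<notin> A \<and> (\<forall>k\<le>n - 2. load A S k n \<le> 0)"
  proof (cases "1 \<in> A")
    case True
    then have "\<not> (of_bool (1 \<in> A) + load A S 0 n \<le> 0)" by auto
    then show ?thesis using True by blast
  qed simp
  also have "(\<forall>k\<le>n - 2. load A S k n \<le> 0) \<longleftrightarrow> (\<forall>x\<ge>3. card (A \<inter> {x..}) \<le> card (S \<inter> {x..}))"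
    using all_tails_iff[OF assms(1,2), of "n - 2"] two_le_n by (simp add: Suc_le_eq numeral_3_eq_3 numeral_2_eq_2)
  finally show ?thesis by blast
qed

text \<open>
  The part to be removed from a product event, in which line \<open>A\<close> is unconstrained, to obtain the
  multiline configurations that produce the required species at sites 1, 2, 3.
\<close>

definition blocked :: "nat \<Rightarrow> nat \<Rightarrow> nat \<Rightarrow> (nat set \<times> nat set \<times> nat set) set" where
  "blocked a b c = {(A, B, C) \<in> multiline a b c.
     2 \<in> C \<and> 3 \<notin> C \<and> 1 \<in> unused B C \<and> 2 \<in> B \<and> 2 \<in> unused A B}"

text \<open>The tail conditions at 2 and 3 follow from \<open>a < b < c\<close> and the fixed
  memberships. What is left separates sites 1, 2, 3 from a ballot condition on the sites above
  them.\<close>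

lemma blocked_iff:
  assumes n: "3 \<le> n" and ab: "a < b" and bc: "b < c"
  shows "(A, B, C) \<in> blocked a b c \<longleftrightarrow>
    (A, B, C) \<in> multiline a b c \<and> 1 \<in> C \<and> 2 \<in> C \<and> 3 \<notin> C \<and> 1 \<notin> B \<and> 2 \<in> B \<and> 1 \<notin> A \<and> 2 \<notin> A \<and>
    (\<forall>x\<ge>4. card (A \<inter> {x..}) \<le> card (B \<inter> {x..}) \<and> card (B \<inter> {x..}) \<le> card (C \<inter> {x..}))"
proof (cases "(A, B, C) \<in> multiline a b c")
  case True
  then have sub: "A \<subseteq> sites" "B \<subseteq> sites" "C \<subseteq> sites" and cards: "card A = a" "card B = b" "card C = c"
    by (auto simp: multiline_def lines_def)
  have fin: "finite A" "finite B" "finite C" using sub finite_subset[OF _ finite_sites] by auto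
  have tail: "D \<inter> {2..} = D - {1}" "D \<inter> {3..} = D - {1} - {2}" if "D \<subseteq> sites" for D
    using that by (auto simp: sites_def)
  have "x \<ge> 2 \<longleftrightarrow> x = 2 \<or> x = 3 \<or> x \<ge> 4" "x \<ge> 3 \<longleftrightarrow> x = 3 \<or> x \<ge> 4" for x :: nat by auto
  then have ex2: "(\<forall>x\<ge>2. P x) \<longleftrightarrow> P 2 \<and> P 3 \<and> (\<forall>x\<ge>4. P x)"
    and ex3: "(\<forall>x\<ge>3. P x) \<longleftrightarrow> P 3 \<and> (\<forall>x\<ge>4. P x)" for P :: "nat \<Rightarrow> bool"
    by metis+
  show ?thesis
  proof (cases "1 \<in> C \<and> 2 \<in> C \<and> 1 \<notin> B \<and> 2 \<in> B")
    case ABC: True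
    then have "card (B \<inter> {2..}) \<le> card (C \<inter> {2..})" "card (B \<inter> {3..}) \<le> card (C \<inter> {3..})"
      using sub fin cards bc by (simp_all add: tail card_Diff_singleton_if)
    then have 1: "1 \<in> unused B C \<longleftrightarrow> (\<forall>x\<ge>4. card (B \<inter> {x..}) \<le> card (C \<inter> {x..}))"
      using ABC by (simp add: one_unused_iff[OF sub(2,3)] ex2 del: One_nat_def)
    have "card (A \<inter> {3..}) \<le> card (B \<inter> {3..})" if "1 \<notin> A" "2 \<notin> A"
      using ABC that sub fin cards ab by (simp add: tail card_Diff_singleton_if del: One_nat_def)
    then have 2: "2 \<in> unused A B \<longleftrightarrow> 1 \<notin> A \<and> 2 \<notin> A \<and> (\<forall>x\<ge>4. card (A \<inter> {x..}) \<le> card (B \<inter> {x..}))"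
      using ABC by (auto simp: two_unused_iff[OF sub(1,2)] ex3 simp del: One_nat_def)
    show ?thesis using ABC True unfolding blocked_def by (simp add: 1 2 del: One_nat_def) blast
  next
    case False
    then show ?thesis unfolding blocked_def using one_unused_iff[OF sub(2,3)] by (auto simp del: One_nat_def)
  qed
qed (simp add: blocked_def)

text \<open>On sites 1, 2, 3 only the memberships of 3 in \<open>A\<close> and in \<open>B\<close>
  are free; they are the indices \<open>t\<close> and \<open>u\<close>.\<close>

lemma card_blocked:
  assumes n: "3 \<le> n" and ab: "a < b" and bc: "b < c"
  shows "card (blocked a b c) = (\<Sum>t\<in>UNIV. \<Sum>u\<in>UNIV.
     card (ballot_triples n (n - 3) (int c - 2) (int b - 1 - of_bool u) (int a - of_bool t)))"
proof -
  \<comment> \<open>\<open>False = v\<close> is a dummy third index, which lets the three-way split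
    be used for two free memberships.\<close>
  have fibre: "card {z \<in> blocked a b c. (3 \<in> fst z) = t \<and> (3 \<in> fst (snd z)) = u \<and> False = v}
      = (if v then 0 else
         card (ballot_triples n (n - 3) (int c - 2) (int b - 1 - of_bool u) (int a - of_bool t)))"
    (is "card ?L = (if v then 0 else card ?R)") for t u v
  proof (cases v)
    case False
    let ?f = "\<lambda>(A, B, C). (A - {3}, B - {3} - {2}, C - {1} - {2 :: nat})"
    let ?g = "\<lambda>(A, B, C). (add_if t 3 A, insert 2 (add_if u 3 B), insert 1 (insert 2 C))"
    have "bij_betw ?f ?L ?R"
    proof (rule bij_betw_byWitness[where f'="?g"])
      show "\<forall>z\<in>?L. ?g (?f z) = z"
        by (auto simp: blocked_iff[OF assms] add_if_def)
      show "\<forall>z\<in>?R. ?f (?g z) = z"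
        using n by (auto simp: ballot_triples_def add_if_def)
      show "?f ` ?L \<subseteq> ?R"
      proof (rule image_subsetI)
        fix z assume "z \<in> ?L"
        moreover obtain A B C where zeq: "z = (A, B, C)" by (cases z)
        ultimately have z: "(A, B, C) \<in> blocked a b c" and tu: "(3 \<in> A) = t" "(3 \<in> B) = u"
          by simp_all
        then have mem: "1 \<in> C" "2 \<in> C" "3 \<notin> C" "1 \<notin> B" "2 \<in> B" "1 \<notin> A" "2 \<notin> A"
          and tl: "\<And>x. x \<ge> 4 \<Longrightarrow> card (A \<inter> {x..}) \<le> card (B \<inter> {x..})"
            "\<And>x. x \<ge> 4 \<Longrightarrow> card (B \<inter> {x..}) \<le> card (C \<inter> {x..})"
          and sub: "A \<subseteq> sites" "B \<subseteq> sites" "C \<subseteq> sites"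
          and cards: "card A = a" "card B = b" "card C = c"
          by (auto simp: blocked_iff[OF assms] multiline_def lines_def)
        have fin: "finite A" "finite B" "finite C" using sub finite_subset[OF _ finite_sites] by auto
        have above: "D \<subseteq> {3<..n}" if "D \<subseteq> sites" "1 \<notin> D" "2 \<notin> D" "3 \<notin> D" for D
        proof
          fix x assume "x \<in> D"
          then have "x \<in> sites" "x \<noteq> 1" "x \<noteq> 2" "x \<noteq> 3" using that by auto
          then show "x \<in> {3<..n}" by (simp add: sites_def)
        qed
        have ranges: "A - {3} \<subseteq> {3<..n}" "B - {3} - {2} \<subseteq> {3<..n}" "C - {1} - {2} \<subseteq> {3<..n}"
          using mem sub by (intro above; auto)+
        then have tA: "(A - {3}) \<inter> {x..} = A \<inter> {max x 4..}"
          and tB: "(B - {3} - {2}) \<inter> {x..} = B \<inter> {max x 4..}"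
          and tC: "(C - {1} - {2}) \<inter> {x..} = C \<inter> {max x 4..}" for x
          by (auto simp: subset_iff Suc_le_eq numeral_eq_Suc)
        note ranges
        moreover have "int (card (A - {3})) = int a - of_bool t"
          using card_Suc_Diff1[of A 3] fin cards tu by (cases t) auto
        moreover have "int (card (B - {3} - {2})) = int b - 1 - of_bool u"
          using card_Suc_Diff1[of B 3] card_Suc_Diff1[of "B - {3}" 2] fin cards tu mem by (cases u) auto
        moreover have "int (card (C - {1} - {2})) = int c - 2"
          using card_Suc_Diff1[of C 1] card_Suc_Diff1[of "C - {1}" 2] fin cards mem by auto
        ultimately show "?f z \<in> ?R"
          unfolding zeq using n tl by (simp add: ballot_triples_def tA tB tC del: One_nat_def)
      qed
      show "?g ` ?R \<subseteq> ?L"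
      proof (rule image_subsetI)
        fix z assume "z \<in> ?R"
        moreover obtain A B C where zeq: "z = (A, B, C)" by (cases z)
        ultimately have sub: "A \<subseteq> {3<..n}" "B \<subseteq> {3<..n}" "C \<subseteq> {3<..n}"
          and cards: "int (card A) = int a - of_bool t" "int (card B) = int b - 1 - of_bool u"
            "int (card C) = int c - 2"
          and tl: "\<And>x. card (A \<inter> {x..}) \<le> card (B \<inter> {x..})" "\<And>x. card (B \<inter> {x..}) \<le> card (C \<inter> {x..})"
          using n by (auto simp: ballot_triples_def)
        have fin: "finite A" "finite B" "finite C" "1 \<notin> A" "1 \<notin> B" "1 \<notin> C"
            "2 \<notin> A" "2 \<notin> B" "2 \<notin> C" "3 \<notin> A" "3 \<notin> B" "3 \<notin> C"
          using sub by (auto intro: finite_subset[OF _ finite_greaterThanAtMost])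
        have "int (card (add_if t 3 A)) = int a" "int (card (insert 2 (add_if u 3 B))) = int b"
            "int (card (insert 1 (insert 2 C))) = int c"
          using fin cards by (auto simp: add_if_def)
        moreover have "add_if t 3 A \<subseteq> sites" "insert 2 (add_if u 3 B) \<subseteq> sites"
            "insert 1 (insert 2 C) \<subseteq> sites"
          using sub n by (auto simp: add_if_def sites_def)
        moreover have "add_if t 3 A \<inter> {x..} = A \<inter> {x..}" "insert 2 (add_if u 3 B) \<inter> {x..} = B \<inter> {x..}"
            "insert 1 (insert 2 C) \<inter> {x..} = C \<inter> {x..}" if "x \<ge> 4" for x
          using that by (auto simp: add_if_def)
        ultimately show "?g z \<in> ?L"
          unfolding zeq using False tl fin
          by (auto simp: blocked_iff[OF assms] multiline_def lines_def add_if_def)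
      qed
    qed
    then show ?thesis using False by (simp add: bij_betw_same_card)
  qed simp
  have "finite (blocked a b c)"
    by (rule finite_subset[OF _ finite_multiline[of a b c]]) (auto simp: blocked_def)
  from card_split_bool3[OF this, where f="\<lambda>z. 3 \<in> fst z" and g="\<lambda>z. 3 \<in> fst (snd z)" and h="\<lambda>_. False"]
  show ?thesis unfolding fibre by (simp add: UNIV_bool)
qed

end

text \<open>The value of the three-threshold probability, as found from two values of
  \<open>blocked_num\<close> after cancelling one factor \<open>n - 1\<close>. Real arguments turn
  the later mixed difference into a polynomial identity.\<close>

definition corr :: "real \<Rightarrow> real \<Rightarrow> real \<Rightarrow> real \<Rightarrow> real" where
  "corr n a b c = (n - c) * (a * (c - b) * (c + b - a) * (n - 1) * (n - 2)
      + c * ((2 * c * a - a * (a + 1)) * (n - 2) + 2 * a * (c - 1)))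
    / (n ^ 3 * (n - 1) ^ 2 * (n - 2))"

text \<open>A determinant expanded along its row for \<open>c\<close>. The entries are
  falling-factorial numerators of binomial ratios: for \<open>c\<close> those of
  \<open>n - 3\<close> against \<open>n\<close>, for \<open>x = b\<close> and \<open>x = a\<close>
  the entries \<open>x (x - 1)\<close>, \<open>x (n - x)\<close>, \<open>(n - x) (n - x - 1)\<close>
  of \<open>n - 2\<close> against \<open>n\<close>.\<close>

definition blocked_num :: "real \<Rightarrow> real \<Rightarrow> real \<Rightarrow> real \<Rightarrow> real" where
  "blocked_num n a b c =
     c * (c - 1) * (n - c) * (b * (n - b) * ((n - a) * (n - a - 1)) - (n - b) * (n - b - 1) * (a * (n - a)))
   - c * (n - c) * (n - c - 1) * (b * (b - 1) * ((n - a) * (n - a - 1)) - (n - b) * (n - b - 1) * (a * (a - 1)))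
   + (n - c) * (n - c - 1) * (n - c - 2) * (b * (b - 1) * (a * (n - a)) - b * (n - b) * (a * (a - 1)))"

lemma blocked_num_corr:
  assumes "n \<ge> (3 :: real)"
  shows "(blocked_num n 0 b c - blocked_num n a b c) / (n ^ 3 * (n - 1) ^ 3 * (n - 2)) = corr n a b c"
proof -
  have "blocked_num n 0 b c - blocked_num n a b c = (n - 1) * ((n - c) * (a * (c - b) * (c + b - a) * (n - 1) * (n - 2)
      + c * ((2 * c * a - a * (a + 1)) * (n - 2) + 2 * a * (c - 1))))"
    unfolding blocked_num_def by algebra
  then show ?thesis
    using assms by (simp add: corr_def power3_eq_cube power2_eq_square)
qed

section \<open>Binomial ratios and the proportion of blocked configurations\<close>

lemma bin_drop2:
  assumes n: "real n = real m + 2"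
  shows "real n * (real n - 1) * bin m (k - 2) = of_int k * (of_int k - 1) * bin n k"
    and "real n * (real n - 1) * bin m (k - 1) = of_int k * (real n - of_int k) * bin n k"
    and "real n * (real n - 1) * bin m k = (real n - of_int k) * (real n - of_int k - 1) * bin n k"
proof -
  have e: "n = Suc (Suc m)" using n by linarith
  note r = bin_absorb[of "Suc m"] bin_absorb'[of "Suc m"] bin_absorb[of m] bin_absorb'[of m]
  have 1: "real n * bin (Suc m) (k - 1) = of_int k * bin n k"
    and 2: "real n * bin (Suc m) k = (real n - of_int k) * bin n k"
    and 3: "(real n - 1) * bin m (k - 2) = (of_int k - 1) * bin (Suc m) (k - 1)"
    and 4: "(real n - 1) * bin m (k - 1) = of_int k * bin (Suc m) k"
    and 5: "(real n - 1) * bin m k = (real n - of_int k - 1) * bin (Suc m) k"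
    using r(1)[of k] r(2)[of k] r(3)[of "k - 1"] r(3)[of k] r(4)[of k] by (simp_all add: e algebra_simps)
  show "real n * (real n - 1) * bin m (k - 2) = of_int k * (of_int k - 1) * bin n k"
    using 1 3 by algebra
  show "real n * (real n - 1) * bin m (k - 1) = of_int k * (real n - of_int k) * bin n k"
    using 2 4 by algebra
  show "real n * (real n - 1) * bin m k = (real n - of_int k) * (real n - of_int k - 1) * bin n k"
    using 2 5 by algebra
qed

lemma bin_drop3:
  assumes n: "real n = real m + 3"
  shows "real n * (real n - 1) * (real n - 2) * bin m (k - 2)
      = of_int k * (of_int k - 1) * (real n - of_int k) * bin n k"
    and "real n * (real n - 1) * (real n - 2) * bin m (k - 1)
      = of_int k * (real n - of_int k) * (real n - of_int k - 1) * bin n k"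
    and "real n * (real n - 1) * (real n - 2) * bin m k
      = (real n - of_int k) * (real n - of_int k - 1) * (real n - of_int k - 2) * bin n k"
proof -
  have e: "real n = real (Suc m) + 2" using n by simp
  note d = bin_drop2[OF e, of k]
  have 1: "(real n - 2) * bin m (k - 2) = (real n - of_int k) * bin (Suc m) (k - 2)"
    and 2: "(real n - 2) * bin m (k - 1) = (real n - of_int k - 1) * bin (Suc m) (k - 1)"
    and 3: "(real n - 2) * bin m k = (real n - of_int k - 2) * bin (Suc m) k"
    using bin_absorb'[of m "k - 2"] bin_absorb'[of m "k - 1"] bin_absorb'[of m k]
    by (simp_all add: n algebra_simps)
  show "real n * (real n - 1) * (real n - 2) * bin m (k - 2)
      = of_int k * (of_int k - 1) * (real n - of_int k) * bin n k"
    using d(1) 1 by algebra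
  show "real n * (real n - 1) * (real n - 2) * bin m (k - 1)
      = of_int k * (real n - of_int k) * (real n - of_int k - 1) * bin n k"
    using d(2) 2 by algebra
  show "real n * (real n - 1) * (real n - 2) * bin m k
      = (real n - of_int k) * (real n - of_int k - 1) * (real n - of_int k - 2) * bin n k"
    using d(3) 3 by algebra
qed

text \<open>The sum over the free memberships of site 3 is Pascal's rule in the second and third
  rows only, so the row of \<open>C\<close> keeps \<open>m\<close> while the others move to
  \<open>Suc m\<close>.\<close>

lemma ballot_det_sum:
  "(\<Sum>t\<in>UNIV. \<Sum>u\<in>UNIV. ballot_det m p (q - of_bool u) (r - of_bool t)) =
     bin m p * (bin (Suc m) q * bin (Suc m) r - bin (Suc m) (q + 1) * bin (Suc m) (r - 1))
   - bin m (p + 1) * (bin (Suc m) (q - 1) * bin (Suc m) r - bin (Suc m) (q + 1) * bin (Suc m) (r - 2))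
   + bin m (p + 2) * (bin (Suc m) (q - 1) * bin (Suc m) (r - 1) - bin (Suc m) q * bin (Suc m) (r - 2))"
proof -
  have e: "q + 1 - 1 = q" "q - 1 - 1 = q - 2" "q - 1 + 1 = q" "r - 1 - 1 = r - 2"
    "r - 2 - 1 = r - 3" "r - 1 - 2 = r - 3"
    by simp_all
  have "(\<Sum>t\<in>UNIV. \<Sum>u\<in>UNIV. ballot_det m p (q - of_bool u) (r - of_bool t)) =
      ballot_det m p q r + ballot_det m p (q - 1) r + ballot_det m p q (r - 1) + ballot_det m p (q - 1) (r - 1)"
    by (simp add: UNIV_bool)
  then show ?thesis
    unfolding ballot_det_def bin_Suc e by algebra
qed

context site_ring
begin

lemma blocked_diagonal: "blocked b b c = {}"
proof -
  have "2 \<notin> unused A B" if "A \<in> lines b" "B \<in> lines b" for A B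
  proof
    assume u: "2 \<in> unused A B"
    then have "load A B n 2 < 0" and "2 \<in> sites" using two_le_n by (auto simp: unused_def)
    then show False using load_full[of 2 A B] that by (simp add: lines_def)
  qed
  then show ?thesis by (auto simp: blocked_def multiline_def)
qed

text \<open>The normaliser collects \<open>n (n - 1) (n - 2)\<close> from the row of
  \<open>c\<close> and \<open>n (n - 1)\<close> from each of the rows of \<open>b\<close> and
  \<open>a\<close>.\<close>

lemma card_blocked_num:
  assumes n: "3 \<le> n" and ab: "a \<le> b" and bc: "b < c"
  shows "real n ^ 3 * (real n - 1) ^ 3 * (real n - 2) * real (card (blocked a b c))
    = blocked_num (real n) (real a) (real b) (real c) * real (card (multiline a b c))"
proof (cases "a = b")
  case True
  then show ?thesis by (simp add: blocked_diagonal blocked_num_def)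
next
  case False
  define m where "m = n - 3"
  have m3: "real n = real m + 3" and m2: "real n = real (Suc m) + 2" using n by (auto simp: m_def)
  have cb: "real (n choose d) = bin n (int d)" for d by (simp add: bin_def)
  have "real (card (blocked a b c))
      = (\<Sum>t\<in>UNIV. \<Sum>u\<in>UNIV. ballot_det m (int c - 2) (int b - 1 - of_bool u) (int a - of_bool t))"
  proof -
    have "real (card (ballot_triples n m (int c - 2) (int b - 1 - of_bool u) (int a - of_bool t)))
        = ballot_det m (int c - 2) (int b - 1 - of_bool u) (int a - of_bool t)" for t u
      using n ab bc False by (intro card_ballot_triples) (auto simp: m_def)
    then show ?thesis
      using card_blocked[OF n _ bc, of a] ab False by (simp add: m_def)
  qed
  also note ballot_det_sum
  finally have card: "real (card (blocked a b c)) =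
      bin m (int c - 2) * (bin (Suc m) (int b - 1) * bin (Suc m) (int a) - bin (Suc m) (int b) * bin (Suc m) (int a - 1))
    - bin m (int c - 1) * (bin (Suc m) (int b - 2) * bin (Suc m) (int a) - bin (Suc m) (int b) * bin (Suc m) (int a - 2))
    + bin m (int c) * (bin (Suc m) (int b - 2) * bin (Suc m) (int a - 1) - bin (Suc m) (int b - 1) * bin (Suc m) (int a - 2))"
    by (simp add: algebra_simps)
  show ?thesis
    unfolding card_multiline of_nat_mult cb card blocked_num_def
    using bin_drop2[OF m2, of "int a"] bin_drop2[OF m2, of "int b"] bin_drop3[OF m3, of "int c"]
    unfolding of_int_of_nat_eq
    by algebra
qed

section \<open>The event read off the multiline queue\<close>

definition word :: "nat set \<times> nat set \<times> nat set \<Rightarrow> nat set \<times> nat set \<times> nat set" where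
  "word = (\<lambda>(A, B, C). (departures (departures A B) C, departures B C, C))"

text \<open>For the levels \<open>a\<close>, \<open>b\<close>, \<open>c\<close> of a state this is
  \<open>b < w 1 \<le> c\<close>, \<open>w 2 \<le> a\<close>, \<open>c < w 3\<close>.\<close>

definition pattern :: "nat set \<times> nat set \<times> nat set \<Rightarrow> bool" where
  "pattern = (\<lambda>(A, B, C). 1 \<in> C \<and> 1 \<notin> B \<and> 2 \<in> A \<and> 3 \<notin> C)"

lemma pattern_word_iff:
  assumes A: "A \<subseteq> sites" and B: "B \<subseteq> sites" and C: "C \<subseteq> sites"
  shows "pattern (word (A, B, C)) \<longleftrightarrow>
    2 \<in> C \<and> 3 \<notin> C \<and> 1 \<in> unused B C \<and> 2 \<in> B \<and> 2 \<notin> unused A B"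
proof -
  define D where "D = departures A B"
  have DB: "D \<subseteq> B" unfolding D_def by (rule departures_subset)
  have one: "1 \<in> C \<and> 1 \<notin> departures B C \<longleftrightarrow> 1 \<in> unused B C"
    using one_unused_iff[OF B C] by (auto simp: departures_def)
  have "2 \<in> departures D C \<longleftrightarrow> 2 \<in> C \<and> 2 \<in> D" if "1 \<in> unused B C"
  proof -
    have u: "1 \<in> unused D C" using unused_antimono[OF DB] that by blast
    have l2: "left 2 = 1" and s2: "2 \<in> sites" using two_le_n by (auto simp: left_site_def sites_def)
    have ld: "load D C l 1 < 1" if "l < n" for l
      using u that by (cases "l = 0") (auto simp: unused_def intro: less_trans[of _ 0])
    have "2 \<in> unused D C \<longleftrightarrow> 2 \<notin> D" if "2 \<in> C"
    proof (cases "2 \<in> D")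
      case True
      then show ?thesis
        using that two_le_n unfolding unused_iff_Suc l2
        by (auto intro!: exI[of _ 0])
    next
      case False
      then show ?thesis
        using that ld s2 unfolding unused_iff_Suc l2 by auto
    qed
    then show ?thesis by (auto simp: departures_def)
  qed
  then show ?thesis
    using one DB by (auto simp: pattern_def word_def D_def[symmetric]) (auto simp: D_def departures_def)
qed

text \<open>The event and \<open>blocked\<close> together put no condition on \<open>A\<close>, so
  their sizes add up to a product with the factor \<open>n choose a\<close>.\<close>

lemma card_pattern:
  assumes n: "3 \<le> n" and ab: "a \<le> b" and bc: "b < c"
  shows "real (card {z \<in> multiline a b c. pattern (word z)})
    = corr (real n) (real a) (real b) (real c) * real (card (multiline a b c))"
proof -
  let ?P = "{z \<in> multiline a b c. pattern (word z)}"
  define base where "base = {(B, C) \<in> lines b \<times> lines c. 2 \<in> C \<and> 3 \<notin> C \<and> 1 \<in> unused B C \<and> 2 \<in> B}"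
  have sub: "A \<subseteq> sites" if "A \<in> lines k" for A k using that by (simp add: lines_def)
  have "?P \<union> blocked a b c = lines a \<times> base"
    using sub by (auto simp: pattern_word_iff blocked_def multiline_def base_def)
  moreover have "?P \<inter> blocked a b c = {}"
    using sub by (auto simp: pattern_word_iff blocked_def multiline_def)
  moreover have fb: "finite (blocked a b c)" "finite ?P"
    using finite_multiline[of a b c] by (auto simp: blocked_def intro: finite_subset)
  ultimately have "card ?P + card (blocked a b c) = (n choose a) * card base"
    using card_Un_disjoint[OF fb(2,1)] by (simp add: card_cartesian_product card_lines)
  moreover have "blocked 0 b c = {{}} \<times> base"
  proof -
    have "2 \<in> unused {} B" if "1 \<in> unused B C" "2 \<in> B" "B \<in> lines b" "C \<in> lines c" for B C
      using that sub two_unused_iff[of "{}" B] one_unused_iff[of B C] by auto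
    moreover have "lines 0 = {{}}"
      using finite_subset[OF _ finite_sites] by (auto simp: lines_def)
    ultimately show ?thesis
      by (auto simp: blocked_def multiline_def base_def)
  qed
  ultimately have "card ?P + card (blocked a b c) = (n choose a) * card (blocked 0 b c)"
    by (simp add: card_cartesian_product)
  then have eq: "real (card ?P) = real (n choose a) * real (card (blocked 0 b c)) - real (card (blocked a b c))"
    unfolding of_nat_mult[symmetric] by linarith
  have le0: "0 \<le> b" by simp
  define K where "K = real n ^ 3 * (real n - 1) ^ 3 * (real n - 2)"
  have K: "K > 0" using n by (simp add: K_def)
  have m0: "real (card (multiline a b c)) = real (n choose a) * real (card (multiline 0 b c))"
    by (simp add: card_multiline)
  have "K * real (card ?P) = (blocked_num (real n) 0 (real b) (real c) - blocked_num (real n) (real a) (real b) (real c))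
      * real (card (multiline a b c))"
    unfolding eq using card_blocked_num[OF n le0 bc] card_blocked_num[OF n ab bc] m0
    unfolding K_def of_nat_0 by algebra
  then have "real (card ?P) = (blocked_num (real n) 0 (real b) (real c) - blocked_num (real n) (real a) (real b) (real c))
      / K * real (card (multiline a b c))"
    using K by (simp add: field_simps)
  then show ?thesis
    using blocked_num_corr[of "real n"] n unfolding K_def by simp
qed

end

subsection \<open>From the generator to nested sets\<close>

lemma abs_gen_power_le:
  assumes "finite S" "v \<in> S"
  shows "\<bar>gen_power S Q m u v\<bar> \<le> (\<Sum>x\<in>S. \<Sum>y\<in>S. \<bar>Q x y\<bar>) ^ m"
  using assms(2)
proof (induction m arbitrary: v)
  case (Suc m)
  let ?K = "\<Sum>x\<in>S. \<Sum>y\<in>S. \<bar>Q x y\<bar>"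
  have K0: "?K \<ge> 0" by (intro sum_nonneg) auto
  have "\<bar>gen_power S Q (Suc m) u v\<bar> \<le> (\<Sum>x\<in>S. \<bar>gen_power S Q m u x\<bar> * \<bar>Q x v\<bar>)"
    unfolding gen_power.simps abs_mult[symmetric] by (rule sum_abs)
  also have "\<dots> \<le> (\<Sum>x\<in>S. ?K ^ m * (\<Sum>y\<in>S. \<bar>Q x y\<bar>))"
    using Suc assms(1) K0
    by (intro sum_mono mult_mono) (auto intro: member_le_sum[of v S "\<lambda>y. \<bar>Q _ y\<bar>"])
  also have "\<dots> = ?K ^ Suc m"
    by (simp only: sum_distrib_left[symmetric] power_Suc2)
  finally show ?case .
qed simp

text \<open>\<open>p\<close> times the matrix exponential is a power series in \<open>t\<close> that
  is constant for \<open>t \<ge> 0\<close>; its first coefficient is the claimed sum.\<close>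

lemma stationary_generator:
  assumes fin: "finite S" and st: "stationary S Q p" and v: "v \<in> S"
  shows "(\<Sum>u\<in>S. pmf p u * Q u v) = 0"
proof -
  define K where "K = (\<Sum>x\<in>S. \<Sum>y\<in>S. \<bar>Q x y\<bar>)"
  define a where "a m = (\<Sum>u\<in>S. pmf p u * gen_power S Q m u v) / fact m" for m
  have summable_u: "summable (\<lambda>m. t ^ m / fact m * gen_power S Q m u v)" for u t
  proof (rule summable_comparison_test)
    show "summable (\<lambda>m. (\<bar>t\<bar> * K) ^ m /\<^sub>R fact m)"
      using summable_exp_generic[of "\<bar>t\<bar> * K"] .
    show "\<exists>N. \<forall>m\<ge>N. norm (t ^ m / fact m * gen_power S Q m u v) \<le> (\<bar>t\<bar> * K) ^ m /\<^sub>R fact m"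
    proof (intro exI allI impI)
      fix m
      have "norm (t ^ m / fact m * gen_power S Q m u v)
          = \<bar>t\<bar> ^ m * \<bar>gen_power S Q m u v\<bar> / fact m"
        by (simp add: abs_mult power_abs)
      also have "\<dots> \<le> \<bar>t\<bar> ^ m * K ^ m / fact m"
        using abs_gen_power_le[OF fin v, of Q m u]
        by (intro divide_right_mono mult_left_mono) (auto simp: K_def)
      finally show "norm (t ^ m / fact m * gen_power S Q m u v) \<le> (\<bar>t\<bar> * K) ^ m /\<^sub>R fact m"
        by (simp add: power_mult_distrib field_simps)
    qed
  qed
  have sums: "(\<lambda>m. a m * t ^ m) sums (\<Sum>u\<in>S. pmf p u * transition_prob S Q t u v)" for t
  proof -
    have "(\<lambda>m. \<Sum>u\<in>S. pmf p u * (t ^ m / fact m * gen_power S Q m u v)) sums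
        (\<Sum>u\<in>S. pmf p u * transition_prob S Q t u v)"
      unfolding transition_prob_def using summable_u
      by (intro sums_sum sums_mult) (auto simp: summable_sums)
    moreover have "(\<Sum>u\<in>S. pmf p u * (t ^ m / fact m * gen_power S Q m u v)) = a m * t ^ m" for m
      unfolding a_def sum_divide_distrib sum_distrib_right by (intro sum.cong) auto
    ultimately show ?thesis by simp
  qed
  define g where "g t = (\<Sum>m. a m * t ^ m)" for t
  have const: "g t = pmf p v" if "t \<ge> 0" for t
    using sums[of t] st v that by (simp add: g_def sums_iff stationary_def)
  have "DERIV g 0 :> (\<Sum>m. diffs a m * 0 ^ m)"
    unfolding g_def using sums[of 1] by (intro termdiffs_strong[where K=1]) (auto simp: sums_iff)
  moreover have "(\<Sum>m. diffs a m * 0 ^ m) = a 1"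
    by (simp add: diffs_def)
  ultimately have "((\<lambda>h. (g (0 + h) - g 0) / h) \<longlongrightarrow> a 1) (at 0)"
    by (simp add: DERIV_def)
  \<comment> \<open>Stationarity speaks of \<open>t \<ge> 0\<close> only, so the two-sided
    derivative is evaluated along a positive null sequence.\<close>
  moreover have "filterlim (\<lambda>k. inverse (real (Suc k))) (at 0) sequentially"
    unfolding filterlim_at using LIMSEQ_inverse_real_of_nat by auto
  ultimately have "(\<lambda>k. (g (0 + inverse (real (Suc k))) - g 0) / inverse (real (Suc k))) \<longlonglongrightarrow> a 1"
    by (rule filterlim_compose)
  moreover have "(g (0 + inverse (real (Suc k))) - g 0) / inverse (real (Suc k)) = 0" for k
    using const[of "0 + inverse (real (Suc k))"] const[of 0] by simp
  ultimately have "(\<lambda>k :: nat. 0 :: real) \<longlonglongrightarrow> a 1" by simp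
  then have "a 1 = 0" using LIMSEQ_unique tendsto_const by metis
  moreover have "gen_power S Q 1 u v = Q u v" if "u \<in> S" for u
    using fin that by (simp add: of_bool_def if_distrib[of "\<lambda>x. x * _"] cong: if_cong)
  ultimately show ?thesis
    by (simp add: a_def cong: sum.cong)
qed

context site_ring
begin

definition level :: "nat \<Rightarrow> (nat \<Rightarrow> nat) \<Rightarrow> nat set" where
  "level a w = {s \<in> sites. w s \<le> a}"

lemma finite_states: "finite (tasep_states n)"
  unfolding tasep_states_def by (rule finite_permutations) simp

lemma tasep_ring_states:
  assumes "s \<in> sites" "w \<in> tasep_states n"
  shows "tasep_ring n w s \<in> tasep_states n"
proof -
  have "w(left s := w s, s := w (left s)) = w \<circ> Transposition.transpose (left s) s"
    by (auto simp: fun_eq_iff transpose_def)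
  moreover have "Transposition.transpose (left s) s permutes {1..n}"
    using assms(1) left_in_sites[OF assms(1)] by (intro permutes_swap_id) (auto simp: sites_def)
  ultimately show ?thesis
    using assms(2) by (auto simp: tasep_states_def tasep_ring_def Let_def permutes_compose)
qed

lemma level_lines:
  assumes "w \<in> tasep_states n" "a \<le> n"
  shows "level a w \<in> lines a"
proof -
  have w: "bij_betw w {1..n} {1..n}"
    using assms(1) by (simp add: tasep_states_def permutes_imp_bij)
  have "w ` level a w = {1..a}"
  proof
    show "w ` level a w \<subseteq> {1..a}" using w by (auto simp: level_def sites_def bij_betw_def)
    show "{1..a} \<subseteq> w ` level a w"
    proof
      fix x assume x: "x \<in> {1..a}"
      then have "x \<in> w ` {1..n}" using w assms(2) by (auto simp: bij_betw_def)
      then show "x \<in> w ` level a w" using x by (auto simp: level_def sites_def)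
    qed
  qed
  moreover have "inj_on w (level a w)"
    using w by (auto simp: bij_betw_def level_def sites_def intro: inj_on_subset)
  ultimately have "card (level a w) = a" by (metis card_atLeastAtMost card_image diff_Suc_1)
  then show ?thesis by (auto simp: lines_def level_def)
qed

text \<open>An exchange not separated by \<open>a\<close> has both or neither of its sites in the
  level, and without an exchange \<open>s\<close> in the level implies \<open>left s\<close> in it;
  in these cases the jump is void too.\<close>

lemma level_tasep_ring:
  assumes "s \<in> sites"
  shows "level a (tasep_ring n w s) = jump s (level a w)"
proof (rule set_eqI)
  fix x
  show "x \<in> level a (tasep_ring n w s) \<longleftrightarrow> x \<in> jump s (level a w)"
    unfolding mem_jump[OF assms] using assms left_in_sites[OF assms] left_neq[OF assms]
    by (auto simp: level_def tasep_ring_def Let_def)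
qed

lemma tasep_invariant_weight:
  assumes "tasep_stationary n p"
  shows "invariant_weight sites (\<lambda>s w. tasep_ring n w s) (tasep_states n) (pmf p)"
  unfolding invariant_weight_def
proof
  fix v assume v: "v \<in> tasep_states n"
  let ?S = "tasep_states n"
  have fibre: "(\<Sum>u\<in>?S. pmf p u * of_bool (f u = v)) = (\<Sum>u | u \<in> ?S \<and> f u = v. pmf p u)" for f
    unfolding sum.inter_filter[OF finite_states] by (intro sum.cong) auto
  have "0 = (\<Sum>u\<in>?S. pmf p u * tasep_generator n u v)"
    using stationary_generator[OF finite_states _ v] assms by (simp add: tasep_stationary_def)
  also have "\<dots> = (\<Sum>u\<in>?S. \<Sum>s\<in>sites. pmf p u * of_bool (tasep_ring n u s = v) - pmf p u * of_bool (u = v))"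
    by (simp add: tasep_generator_def sum_distrib_left sites_def right_diff_distrib)
  also have "\<dots> = (\<Sum>s\<in>sites. \<Sum>u\<in>?S. pmf p u * of_bool (tasep_ring n u s = v) - pmf p u * of_bool (u = v))"
    by (rule sum.swap)
  also have "\<dots> = (\<Sum>s\<in>sites. \<Sum>u | u \<in> ?S \<and> tasep_ring n u s = v. pmf p u)
      - (\<Sum>s\<in>sites. \<Sum>u | u \<in> ?S \<and> u = v. pmf p u)"
    by (simp add: sum_subtractf fibre)
  also have "{u. u \<in> ?S \<and> u = v} = {v}" using v by auto
  finally show "(\<Sum>s\<in>sites. \<Sum>u | u \<in> ?S \<and> tasep_ring n u s = v. pmf p u) = real (card sites) * pmf p v"
    by simp
qed

section \<open>The chain of three nested sets and its sorting descent\<close>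

definition nested :: "nat \<Rightarrow> nat \<Rightarrow> nat \<Rightarrow> (nat set \<times> nat set \<times> nat set) set" where
  "nested a b c = {(A, B, C) \<in> multiline a b c. A \<subseteq> B \<and> B \<subseteq> C}"

definition nested_ring ::
    "nat \<Rightarrow> nat set \<times> nat set \<times> nat set \<Rightarrow> nat set \<times> nat set \<times> nat set" where
  "nested_ring s = (\<lambda>(A, B, C). (jump s A, jump s B, jump s C))"

lemma finite_nested: "finite (nested a b c)"
  by (rule finite_subset[OF _ finite_multiline]) (auto simp: nested_def)

lemma nested_ring_in: "s \<in> sites \<Longrightarrow> x \<in> nested a b c \<Longrightarrow> nested_ring s x \<in> nested a b c"
  by (auto simp: nested_def nested_ring_def multiline_def jump_lines)
     (metis jump_mono subsetD)+

text \<open>Site 1 is excluded because its ring moves a particle from 1 to \<open>n\<close> and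
  raises the sum.\<close>

lemma sum_jump:
  assumes s: "s \<in> sites" "s \<noteq> 1" and A: "A \<subseteq> sites"
  shows "\<Sum>(jump s A) \<le> \<Sum>A" and "jump s A \<noteq> A \<Longrightarrow> \<Sum>(jump s A) < \<Sum>A"
proof -
  have fin: "finite A" using A finite_subset[OF _ finite_sites] by blast
  have l: "left s < s" using s by (auto simp: left_site_def sites_def)
  have "\<Sum>(insert (left s) (A - {s})) < \<Sum>A" if "s \<in> A" "left s \<notin> A"
    using fin that l by (simp add: sum.remove[OF fin that(1)])
  then show "\<Sum>(jump s A) \<le> \<Sum>A" "jump s A \<noteq> A \<Longrightarrow> \<Sum>(jump s A) < \<Sum>A"
    by (auto simp: jump_def split: if_splits)
qed

text \<open>If no such ring moves anything, then every \<open>x > 1\<close> in \<open>A\<close> has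
  \<open>x - 1\<close> in \<open>A\<close>, so \<open>A\<close> is an initial segment.\<close>

lemma sorted_line:
  assumes A: "A \<in> lines a" and fixed: "\<And>s. s \<in> sites \<Longrightarrow> s \<noteq> 1 \<Longrightarrow> jump s A = A"
  shows "A = {1..a}"
proof -
  have sub: "A \<subseteq> sites" and card: "card A = a" using A by (auto simp: lines_def)
  have step: "x \<in> A" if "Suc x \<in> A" "x \<ge> 1" for x
  proof -
    have "left (Suc x) = x" using that by (simp add: left_site_def)
    moreover have "Suc x \<in> sites" "Suc x \<noteq> 1" using sub that by auto
    ultimately show ?thesis
      using fixed[of "Suc x"] mem_jump[of "Suc x" x A] that by auto
  qed
  have "A \<subseteq> {1..a}"
  proof
    fix x assume x: "x \<in> A"
    have "x - k \<in> A" if "k < x" for k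
      using that
    proof (induction k)
      case (Suc k)
      then have "x - k = Suc (x - Suc k)" "x - Suc k \<ge> 1" by auto
      then show ?case using step[of "x - Suc k"] Suc by auto
    qed (use x in simp)
    then have down: "y \<in> A" if "y \<in> {1..x}" for y
      using that by (metis (no_types) One_nat_def Suc_le_eq atLeastAtMost_iff diff_diff_cancel diff_less less_le_trans)
    have "finite A" using sub finite_subset[OF _ finite_sites] by blast
    then have "card {1..x} \<le> card A" using down by (intro card_mono) auto
    then show "x \<in> {1..a}" using card x sub by (auto simp: sites_def)
  qed
  then show ?thesis using card by (intro card_subset_eq) auto
qed

text \<open>Provides the descent towards a sink for \<open>invariant_weight_unique\<close>. One ring
  acts on all three sets, but away from site 1 none of the sums can rise.\<close>

lemma nested_descent:
  assumes x: "x \<in> nested a b c" "x \<noteq> ({1..a}, {1..b}, {1..c})"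
  defines "\<Phi> \<equiv> \<lambda>(A, B, C). \<Sum>A + \<Sum>B + \<Sum>C"
  shows "\<exists>s\<in>sites. \<Phi> (nested_ring s x) < \<Phi> x"
proof -
  obtain A B C where xe: "x = (A, B, C)" by (cases x)
  have m: "A \<in> lines a" "B \<in> lines b" "C \<in> lines c"
    using x(1) by (auto simp: xe nested_def multiline_def)
  then have sub: "A \<subseteq> sites" "B \<subseteq> sites" "C \<subseteq> sites" by (auto simp: lines_def)
  obtain s where s: "s \<in> sites" "s \<noteq> 1" "jump s A \<noteq> A \<or> jump s B \<noteq> B \<or> jump s C \<noteq> C"
    using sorted_line m x(2) unfolding xe by blast
  note less = sum_jump(2)[OF s(1,2) sub(1)] sum_jump(2)[OF s(1,2) sub(2)] sum_jump(2)[OF s(1,2) sub(3)]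
  note le = sum_jump(1)[OF s(1,2) sub(1)] sum_jump(1)[OF s(1,2) sub(2)] sum_jump(1)[OF s(1,2) sub(3)]
  have "\<Phi> (nested_ring s x) < \<Phi> x"
    unfolding xe \<Phi>_def nested_ring_def prod.case
    using s(3)
  proof (elim disjE)
    assume "jump s A \<noteq> A"
    from less(1)[OF this] le show "\<Sum>(jump s A) + \<Sum>(jump s B) + \<Sum>(jump s C) < \<Sum>A + \<Sum>B + \<Sum>C" by linarith
  next
    assume "jump s B \<noteq> B"
    from less(2)[OF this] le show "\<Sum>(jump s A) + \<Sum>(jump s B) + \<Sum>(jump s C) < \<Sum>A + \<Sum>B + \<Sum>C" by linarith
  next
    assume "jump s C \<noteq> C"
    from less(3)[OF this] le show "\<Sum>(jump s A) + \<Sum>(jump s B) + \<Sum>(jump s C) < \<Sum>A + \<Sum>B + \<Sum>C" by linarith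
  qed
  then show ?thesis using s by blast
qed

subsection \<open>The three-point probabilities\<close>

lemma word_nested:
  assumes "z \<in> multiline a b c" "a \<le> b" "b \<le> c"
  shows "word z \<in> nested a b c"
proof -
  obtain A B C where z: "z = (A, B, C)" by (cases z)
  have m: "A \<in> lines a" "B \<in> lines b" "C \<in> lines c" using assms(1) by (auto simp: z multiline_def)
  have AB: "departures A B \<in> lines a" by (rule departures_lines[OF m(1,2) assms(2)])
  have "departures (departures A B) C \<in> lines a" "departures B C \<in> lines b"
    using departures_lines[OF AB m(3)] departures_lines[OF m(2,3)] assms by simp_all
  then show ?thesis
    using m departures_mono[OF departures_subset[of A B], of C] departures_subset[of B C]
    by (simp add: z word_def nested_def multiline_def)
qed

text \<open>\<open>departures_jump\<close> is used three times: for the queue of \<open>A\<close> at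
  \<open>B\<close> with the bell \<open>t\<close> passed on by \<open>C\<close>, and for the two
  queues at \<open>C\<close> with the bell \<open>s\<close>. Both \<open>B\<close> and
  \<open>departures A B\<close> react to the same \<open>t\<close>.\<close>

lemma word_multiline_ring:
  assumes "z \<in> multiline a b c" "a \<le> b" "b \<le> c" "s \<in> sites"
  shows "word (multiline_ring s z) = nested_ring s (word z)"
proof -
  obtain A B C where z: "z = (A, B, C)" by (cases z)
  have m: "A \<in> lines a" "B \<in> lines b" "C \<in> lines c" using assms(1) by (auto simp: z multiline_def)
  have "departures A B \<in> lines a" by (rule departures_lines[OF m(1,2) assms(2)])
  then have sub: "A \<subseteq> sites" "B \<subseteq> sites" "C \<subseteq> sites" "departures A B \<subseteq> sites"
    and cards: "card A \<le> card B" "card B \<le> card C" "card (departures A B) \<le> card C"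
    using m assms by (auto simp: lines_def)
  define t where "t = bell C s"
  have t: "t \<in> sites" unfolding t_def by (rule bell_in_sites[OF sub(3) assms(4)])
  have "departures (jump (bell B t) A) (jump t B) = jump t (departures A B)"
    by (rule departures_jump[OF sub(1,2) cards(1) t])
  moreover have "departures (jump t (departures A B)) (jump s C) = jump s (departures (departures A B) C)"
    unfolding t_def by (rule departures_jump[OF sub(4,3) cards(3) assms(4)])
  moreover have "departures (jump t B) (jump s C) = jump s (departures B C)"
    unfolding t_def by (rule departures_jump[OF sub(2,3) cards(2) assms(4)])
  ultimately show ?thesis
    by (simp add: z word_def multiline_ring_def nested_ring_def t_def[symmetric])
qed

definition project :: "nat \<Rightarrow> nat \<Rightarrow> nat \<Rightarrow> (nat \<Rightarrow> nat) \<Rightarrow> nat set \<times> nat set \<times> nat set" where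
  "project a b c w = (level a w, level b w, level c w)"

lemma project_nested:
  assumes "w \<in> tasep_states n" "a \<le> b" "b \<le> c" "c \<le> n"
  shows "project a b c w \<in> nested a b c"
proof -
  have "level a w \<in> lines a" "level b w \<in> lines b" "level c w \<in> lines c"
    using assms by (auto intro!: level_lines)
  then show ?thesis
    using assms by (auto simp: project_def nested_def multiline_def level_def)
qed

lemma pmf_states_sum:
  assumes "tasep_stationary n p"
  shows "measure_pmf.prob p {w. P w} = (\<Sum>w\<in>tasep_states n. pmf p w * of_bool (P w))"
proof -
  have sub: "set_pmf p \<subseteq> tasep_states n"
    using assms by (simp add: tasep_stationary_def stationary_def)
  have "measure_pmf.prob p {w. P w} = measure_pmf.prob p ({w. P w} \<inter> set_pmf p)"
    by (rule measure_Int_set_pmf[symmetric])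
  also have "{w. P w} \<inter> set_pmf p = {w \<in> tasep_states n. P w} \<inter> set_pmf p"
    using sub by auto
  also have "measure_pmf.prob p \<dots> = measure_pmf.prob p {w \<in> tasep_states n. P w}"
    by (rule measure_Int_set_pmf)
  also have "\<dots> = (\<Sum>w | w \<in> tasep_states n \<and> P w. pmf p w)"
    using finite_states by (simp add: measure_measure_pmf_finite)
  also have "\<dots> = (\<Sum>w\<in>tasep_states n. pmf p w * of_bool (P w))"
    unfolding sum.inter_filter[OF finite_states] by (intro sum.cong) auto
  finally show ?thesis .
qed

text \<open>The levels of the stationary law and the words of the uniform law are invariant weights
  of the same chain with the same total mass.\<close>

lemma projected_law:
  assumes st: "tasep_stationary n p" and abc: "a \<le> b" "b \<le> c" "c \<le> n" and x: "x \<in> nested a b c"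
  shows "(\<Sum>w | w \<in> tasep_states n \<and> project a b c w = x. pmf p w)
    = real (card {z \<in> multiline a b c. word z = x}) / real (card (multiline a b c))"
proof -
  let ?M = "real (card (multiline a b c))"
  have M: "?M > 0" using abc by (simp add: card_multiline)
  define \<mu> where "\<mu> x = (\<Sum>w | w \<in> tasep_states n \<and> project a b c w = x. pmf p w)" for x
  define \<nu> where "\<nu> x = (\<Sum>z | z \<in> multiline a b c \<and> word z = x. 1 :: real)" for x
  have TX: "nested_ring s ` nested a b c \<subseteq> nested a b c" if "s \<in> sites" for s
    using that nested_ring_in by blast
  have proj: "project a b c ` tasep_states n \<subseteq> nested a b c"
    using project_nested abc by blast
  have wrd: "word ` multiline a b c \<subseteq> nested a b c"
    using word_nested abc by blast
  have \<mu>: "invariant_weight sites nested_ring (nested a b c) \<mu>"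
    unfolding \<mu>_def[abs_def]
    by (rule invariant_weight_pushforward[OF finite_nested finite_states _ proj _ tasep_invariant_weight[OF st]])
       (auto simp: tasep_ring_states project_def nested_ring_def level_tasep_ring)
  have \<nu>: "invariant_weight sites nested_ring (nested a b c) \<nu>"
    unfolding \<nu>_def[abs_def]
    by (rule invariant_weight_pushforward[OF finite_nested finite_multiline _ wrd _ multiline_uniform_invariant])
       (use multiline_ring_in word_multiline_ring abc in blast)+
  have scaled: "invariant_weight sites nested_ring (nested a b c) (\<lambda>x. \<nu> x / ?M)"
    using invariant_weight_linear[OF \<nu> \<nu>, of "1 / ?M" 0] by simp
  have "sum \<mu> (nested a b c) = sum (pmf p) (tasep_states n)"
    unfolding \<mu>_def by (rule sum_fibres[OF finite_states finite_nested proj])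
  also have "\<dots> = 1"
    using pmf_states_sum[OF st, of "\<lambda>_. True"] by simp
  also have "1 = (\<Sum>x\<in>nested a b c. \<nu> x) / ?M"
    unfolding \<nu>_def using M sum_fibres[OF finite_multiline finite_nested wrd, of "\<lambda>_. 1"] by simp
  finally have total: "sum \<mu> (nested a b c) = (\<Sum>x\<in>nested a b c. \<nu> x / ?M)"
    by (simp add: sum_divide_distrib)
  have "\<mu> x = \<nu> x / ?M"
    by (rule invariant_weight_unique[OF finite_nested finite_sites TX \<mu> scaled total nested_descent x])
  then show ?thesis by (simp add: \<mu>_def \<nu>_def)
qed

lemma prob_corr:
  assumes n: "3 \<le> n" and st: "tasep_stationary n p" and abc: "a \<le> b" "b < c" "c \<le> n"
  shows "measure_pmf.prob p {w. b < w 1 \<and> w 1 \<le> c \<and> w 2 \<le> a \<and> c < w 3}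
    = corr (real n) (real a) (real b) (real c)"
proof -
  let ?M = "real (card (multiline a b c))"
  have M: "?M > 0" using abc by (simp add: card_multiline)
  let ?X = "{x \<in> nested a b c. pattern x}"
  have bc: "b \<le> c" using abc by simp
  have pat: "(b < w 1 \<and> w 1 \<le> c \<and> w 2 \<le> a \<and> c < w 3) \<longleftrightarrow> pattern (project a b c w)" for w
    using n by (auto simp: pattern_def project_def level_def sites_def)
  have "measure_pmf.prob p {w. b < w 1 \<and> w 1 \<le> c \<and> w 2 \<le> a \<and> c < w 3}
      = (\<Sum>w | w \<in> tasep_states n \<and> pattern (project a b c w). pmf p w)"
    unfolding pmf_states_sum[OF st] pat sum.inter_filter[OF finite_states] by (intro sum.cong) auto
  also have "\<dots> = (\<Sum>x\<in>?X. \<Sum>w | w \<in> {w \<in> tasep_states n. pattern (project a b c w)} \<and> project a b c w = x. pmf p w)"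
    using project_nested abc(1,3) bc finite_states finite_nested[of a b c]
    by (intro sum_fibres[symmetric]) auto
  also have "\<dots> = (\<Sum>x\<in>?X. \<Sum>w | w \<in> tasep_states n \<and> project a b c w = x. pmf p w)"
    by (intro sum.cong) auto
  also have "\<dots> = (\<Sum>x\<in>?X. real (card {z \<in> multiline a b c. word z = x}) / ?M)"
    using projected_law[OF st abc(1) bc abc(3)] by (intro sum.cong) auto
  also have "\<dots> = (\<Sum>x\<in>?X. \<Sum>z | z \<in> {z \<in> multiline a b c. pattern (word z)} \<and> word z = x. 1) / ?M"
    unfolding sum_divide_distrib by (intro sum.cong) (auto intro!: arg_cong[where f=card])
  also have "(\<Sum>x\<in>?X. \<Sum>z | z \<in> {z \<in> multiline a b c. pattern (word z)} \<and> word z = x. 1)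
      = (\<Sum>z | z \<in> multiline a b c \<and> pattern (word z). 1 :: real)"
    using word_nested abc(1) bc finite_multiline[of a b c] finite_nested[of a b c]
    by (intro sum_fibres) auto
  finally show ?thesis
    using card_pattern[OF n abc(1,2)] M by simp
qed

end

text \<open>Stepping the lower threshold, the \<open>y\<close> threshold and the common threshold
  isolates \<open>x = j\<close>, \<open>y = i\<close> and \<open>z = k\<close>. The common threshold
  also bounds \<open>x\<close> from above, harmlessly since \<open>j \<le> k - 1\<close>.\<close>

lemma of_bool_species_differences:
  assumes "1 \<le> i" "i < j" "j < k"
  shows "(of_bool (x = j \<and> y = i \<and> z = k) :: real) =
      of_bool (j - 1 < x \<and> x \<le> k - 1 \<and> y \<le> i \<and> k - 1 < z)
    - of_bool (j < x \<and> x \<le> k - 1 \<and> y \<le> i \<and> k - 1 < z)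
    - of_bool (j - 1 < x \<and> x \<le> k - 1 \<and> y \<le> i - 1 \<and> k - 1 < z)
    + of_bool (j < x \<and> x \<le> k - 1 \<and> y \<le> i - 1 \<and> k - 1 < z)
    - of_bool (j - 1 < x \<and> x \<le> k \<and> y \<le> i \<and> k < z)
    + of_bool (j < x \<and> x \<le> k \<and> y \<le> i \<and> k < z)
    + of_bool (j - 1 < x \<and> x \<le> k \<and> y \<le> i - 1 \<and> k < z)
    - of_bool (j < x \<and> x \<le> k \<and> y \<le> i - 1 \<and> k < (z :: nat))"
proof -
  have y: "(of_bool (y = i) :: real) = of_bool (y \<le> i) - of_bool (y \<le> i - 1)"
    using assms by (auto simp: of_bool_def)
  have z: "(of_bool (z = k) :: real) = of_bool (k - 1 < z) - of_bool (k < z)"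
    using assms by (auto simp: of_bool_def)
  have x: "(of_bool (x = j) :: real) = of_bool (j - 1 < x \<and> x \<le> c) - of_bool (j < x \<and> x \<le> c)"
    if "j \<le> c" for c
    using assms that by (auto simp: of_bool_def)
  have "(of_bool (x = j \<and> y = i \<and> z = k) :: real)
      = of_bool (x = j) * of_bool (y = i) * of_bool (k - 1 < z)
      - of_bool (x = j) * of_bool (y = i) * of_bool (k < z)"
    unfolding of_bool_conj z by (simp add: algebra_simps)
  also have "\<dots> = (of_bool (j - 1 < x \<and> x \<le> k - 1) - of_bool (j < x \<and> x \<le> k - 1))
        * (of_bool (y \<le> i) - of_bool (y \<le> i - 1)) * of_bool (k - 1 < z)
      - (of_bool (j - 1 < x \<and> x \<le> k) - of_bool (j < x \<and> x \<le> k))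
        * (of_bool (y \<le> i) - of_bool (y \<le> i - 1)) * of_bool (k < z)"
    using x[of "k - 1"] x[of k] assms unfolding y by simp
  finally show ?thesis
    unfolding of_bool_conj by (simp add: algebra_simps)
qed

theorem theorem7p2:
  fixes n i j k :: nat and p :: "(nat \<Rightarrow> nat) pmf"
  assumes "n \<ge> 3"
    and "tasep_stationary n p"
    and "1 \<le> i" and "i < j" and "j < k" and "k \<le> n"
  shows "measure_pmf.prob p {w. w 1 = j \<and> w 2 = i \<and> w 3 = k} =
    (if k > j + 1 then
       2 * (real j - real i) / (real n ^ 3 * (real n - 1))
     else \<comment> \<open>\<open>k = j + 1\<close>\<close>
       2 * (real j - real i) / (real n * (real n - 1)) *
         (1 / real n ^ 2 + real j * (real n - real j) / (real n ^ 2 * (real n - 1)))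
       + 2 * real j * (real j - 1) * (real n - real j)
           / (real n ^ 3 * (real n - 1) ^ 2 * (real n - 2)))"
proof -
  interpret site_ring n using assms(1) by unfold_locales simp
  define h where "h a b c = measure_pmf.prob p {w. b < w 1 \<and> w 1 \<le> c \<and> w 2 \<le> a \<and> c < w 3}"
    for a b c :: nat
  have h: "h a b c = corr n a b c" if "a \<le> b" "b < c" "c \<le> n" for a b c
    unfolding h_def using prob_corr[OF assms(1,2) that] .
  \<comment> \<open>For \<open>k = j + 1\<close> the terms with \<open>b = j\<close> and
    \<open>c = k - 1\<close> are of this form, and \<open>corr\<close> must not be substituted for
    them.\<close>
  have h0: "h a c c = 0" for a c
  proof -
    have "{w :: nat \<Rightarrow> nat. c < w 1 \<and> w 1 \<le> c \<and> w 2 \<le> a \<and> c < w 3} = {}" by auto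
    then show ?thesis by (simp only: h_def measure_empty)
  qed
  have prob: "measure_pmf.prob p {w. w 1 = j \<and> w 2 = i \<and> w 3 = k} =
      h i (j - 1) (k - 1) - h i j (k - 1) - h (i - 1) (j - 1) (k - 1) + h (i - 1) j (k - 1)
    - h i (j - 1) k + h i j k + h (i - 1) (j - 1) k - h (i - 1) j k"
    unfolding h_def pmf_states_sum[OF assms(2)] of_bool_species_differences[OF assms(3-5)]
    by (simp only: distrib_left right_diff_distrib sum.distrib sum_subtractf)
  have r: "real (i - 1) = real i - 1" "real (j - 1) = real j - 1" "real (k - 1) = real k - 1"
    using assms by auto
  define N where "N = real n"
  have N: "N \<ge> 3" using assms by (simp add: N_def)
  then have N0: "N \<noteq> 0" "N - 1 \<noteq> 0" "N - 2 \<noteq> 0" by auto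
  show ?thesis
  proof (cases "k > j + 1")
    case True
    then have "measure_pmf.prob p {w. w 1 = j \<and> w 2 = i \<and> w 3 = k} =
        corr N i (real j - 1) (real k - 1) - corr N i j (real k - 1)
      - corr N (real i - 1) (real j - 1) (real k - 1) + corr N (real i - 1) j (real k - 1)
      - corr N i (real j - 1) k + corr N i j k + corr N (real i - 1) (real j - 1) k - corr N (real i - 1) j k"
      unfolding prob using assms h[of i "j - 1" "k - 1"] h[of i j "k - 1"] h[of "i - 1" "j - 1" "k - 1"]
        h[of "i - 1" j "k - 1"] h[of i "j - 1" k] h[of i j k] h[of "i - 1" "j - 1" k] h[of "i - 1" j k]
      by (simp add: r N_def)
    also have "\<dots> = 2 * (real j - real i) * (N - 1) * (N - 2) / (N ^ 3 * (N - 1) ^ 2 * (N - 2))"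
      unfolding corr_def add_divide_distrib[symmetric] diff_divide_distrib[symmetric]
      by (rule arg_cong[where f="\<lambda>x. x / _"]) algebra
    also have "\<dots> = 2 * (real j - real i) / (N ^ 3 * (N - 1))"
      using N0 by (simp add: power2_eq_square)
    finally show ?thesis using True by (simp add: N_def)
  next
    case False
    then have k: "k = j + 1" using assms by simp
    have "measure_pmf.prob p {w. w 1 = j \<and> w 2 = i \<and> w 3 = k} =
        corr N i (real j - 1) j - corr N (real i - 1) (real j - 1) j
      - corr N i (real j - 1) (real j + 1) + corr N i j (real j + 1)
      + corr N (real i - 1) (real j - 1) (real j + 1) - corr N (real i - 1) j (real j + 1)"
      unfolding prob using assms k h[of i "j - 1" j] h[of "i - 1" "j - 1" j] h[of i "j - 1" k] h[of i j k]
        h[of "i - 1" "j - 1" k] h[of "i - 1" j k]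
      by (simp add: r N_def h0 add.commute)
    also have "\<dots> = (2 * (real j - real i) * (N - 1) * (N - 2) + 2 * (real j - real i) * (real j * (N - real j)) * (N - 2)
        + 2 * real j * (real j - 1) * (N - real j)) / (N ^ 3 * (N - 1) ^ 2 * (N - 2))"
      unfolding corr_def add_divide_distrib[symmetric] diff_divide_distrib[symmetric]
      by (rule arg_cong[where f="\<lambda>x. x / _"]) algebra
    also have "\<dots> = 2 * (real j - real i) / (N * (N - 1)) * (1 / N ^ 2 + real j * (N - real j) / (N ^ 2 * (N - 1)))
       + 2 * real j * (real j - 1) * (N - real j) / (N ^ 3 * (N - 1) ^ 2 * (N - 2))"
    proof -
      have "2 * (real j - real i) / (N * (N - 1)) * (1 / N ^ 2 + real j * (N - real j) / (N ^ 2 * (N - 1)))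
        = (2 * (real j - real i) * (N - 1) * (N - 2) + 2 * (real j - real i) * (real j * (N - real j)) * (N - 2))
          / (N ^ 3 * (N - 1) ^ 2 * (N - 2))"
        using N0 by (simp add: divide_simps power2_eq_square power3_eq_cube) algebra
      then show ?thesis by (simp add: add_divide_distrib)
    qed
    finally show ?thesis using k by (simp add: N_def)
  qed
qed

end
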